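(* Let $(Z,(X,Y))$ be a hidden Markov model, where $Z=(Z_n)_{n\ge1}$ is an aperiodic, time homogeneous and irreducible Markov chain with finite state space $\mathcal{S}$, initial distribution $\mu$, transition matrix $P$ and stationary distribution $\pi$, and where $X=(X_n)_{n\ge1}$ and $Y=(Y_n)_{n\ge1}$ take values in a common finite alphabet $\mathcal{A}$. Let the distribution of the pairs $(X_i,Y_i)$, $i=1,2,3,\ldots$, be symmetric for all states in $Z$, i.e., for all $x,y\in\mathcal{A}$ and all $z\in\mathcal{S}$, $$\mathbb{P}(X_i=x,Y_i=y\mid Z_i=z)=\mathbb{P}(X_i=y,Y_i=x\mid Z_i=z).$$ Let $\alpha\in(0,1)$ and $c>0$ be the constants defined in the context. Then there is a constant $C>0$, depending on the parameters of the model but not on $n$, such that for all $n\ge2$, $$\frac{\mathbb{E}[LC_n]}{n}\ \ge\ \gamma^*-2\beta^*-C\sqrt{\frac{\ln n}{n}}-\frac{2}{n}-(1-\mathbf{1}_{\mu=\pi})\left(\frac{1}{\sqrt n}+c\,\alpha^{\sqrt n}\right).$$ Moreover, with the same $\alpha$ and $c$, for all $n \ge 2$, $$\frac{\mathbb{E}[LC_n]}{n}\ \le\ \gamma^*+(1-\mathbf{1}_{\mu=\pi})\left(\frac{1}{\sqrt n}+c\,\alpha^{\sqrt n}\right).$$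
   Context: Hidden Markov model: $(Z,(X,Y))$ is a hidden Markov model if $Z$ is a Markov chain (the latent chain) and, given $Z$, the pairs $(X_n,Y_n)$, $n\ge1$, are conditionally independent, the conditional law of $(X_n,Y_n)$ depending only on the state $Z_n$, through an emission distribution on $\mathcal{A}\times\mathcal{A}$ associated with that state and not depending on $n$. ($X_n$ and $Y_n$ need not be conditionally independent of each other.) $LC_n$ denotes the length of the longest common subsequences of $X_1,\ldots,X_n$ and $Y_1,\ldots,Y_n$, i.e., the largest $k\ge 0$ such that there exist $1\le i_1<\cdots<i_k\le n$ and $1\le j_1<\cdots<j_k\le n$ with $X_{i_s}=Y_{j_s}$ for all $s=1,\ldots,k$. The number $\gamma^*$ is $\gamma^*=\lim_{n\to\infty}\mathbb{E}[LC_n]/n$ (this limit exists). Write $X^{(n)}=(X_1,\ldots,X_n)$ and $Y^{(n)}=(Y_1,\ldots,Y_n)$. The $\beta$-mixing coefficient of $X^{(n)}$ and $Y^{(n)}$ is $$\beta(n)=\frac12\sum_{u\in\mathcal{A}^n}\sum_{v\in\mathcal{A}^n}\left|\mathbb{P}(X^{(n)}=u,\,Y^{(n)}=v)-\mathbb{P}(X^{(n)}=u)\,\mathbb{P}(Y^{(n)}=v)\right|.$$ It is non-decreasing in $n$ with values in $[0,1]$, and $\beta^*=\lim_{n\to\infty}\beta(n)$. Constants $\alpha$ and $c$: by aperiodicity and irreducibility one may fix an integer $k\ge1$ and $\epsilon\in(0,1)$ such that all entries of $P^k$ are at least $\epsilon$; then $\alpha=(1-\epsilon)^{1/k}$ and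 $c=1/(1-\epsilon)^2$. $\mathbf{1}_{\mu=\pi}$ equals $1$ if $\mu=\pi$ and $0$ otherwise. *)

theory Defs
  imports "HOL-Probability.Probability"
begin

section \<open>Transition matrices\<close>

definition probability_vector :: "real ^ 's \<Rightarrow> bool" where
  "probability_vector v \<longleftrightarrow> (\<forall>s. 0 \<le> v $ s) \<and> (\<Sum>s\<in>UNIV. v $ s) = 1"

definition stochastic_matrix :: "real ^ 's ^ 's \<Rightarrow> bool" where
  "stochastic_matrix P \<longleftrightarrow> (\<forall>s. probability_vector (P $ s))"

text \<open>The type \<open>real ^ 's ^ 's\<close> carries no \<open>power\<close> instance for the matrix product.\<close>

primrec matrix_power :: "real ^ 's ^ 's \<Rightarrow> nat \<Rightarrow> real ^ 's ^ 's" where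
  "matrix_power P 0 = mat 1"
| "matrix_power P (Suc n) = P ** matrix_power P n"

definition irreducible_matrix :: "real ^ 's ^ 's \<Rightarrow> bool" where
  "irreducible_matrix P \<longleftrightarrow> (\<forall>s t. \<exists>n\<ge>1. matrix_power P n $ s $ t > 0)"

definition aperiodic_matrix :: "real ^ 's ^ 's \<Rightarrow> bool" where
  "aperiodic_matrix P \<longleftrightarrow> (\<forall>s. Gcd {n. n \<ge> 1 \<and> matrix_power P n $ s $ s > 0} = 1)"

definition stationary_distribution :: "real ^ 's ^ 's \<Rightarrow> real ^ 's \<Rightarrow> bool" where
  "stationary_distribution P \<pi> \<longleftrightarrow> probability_vector \<pi> \<and> \<pi> v* P = \<pi>"


section \<open>Hidden Markov models\<close>

text \<open>All processes are indexed by \<open>n \<ge> 1\<close>; their value at index \<open>0\<close> is irrelevant.\<close>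

locale finite_markov_chain = prob_space M
  for M :: "'w measure"
    and Z :: "nat \<Rightarrow> 'w \<Rightarrow> 's::finite"
    and \<mu> :: "real ^ 's"
    and P :: "real ^ 's ^ 's" +
  assumes Z_measurable: "\<And>n. n \<ge> 1 \<Longrightarrow> Z n \<in> measurable M (count_space UNIV)"
    and stochastic: "stochastic_matrix P"
    and initial: "\<And>s. prob {\<omega> \<in> space M. Z 1 \<omega> = s} = \<mu> $ s"
    and transition: "\<And>n z s. n \<ge> 1 \<Longrightarrow> prob {\<omega> \<in> space M. \<forall>i\<in>{1..n}. Z i \<omega> = z i} > 0 \<Longrightarrow>
      \<P>(\<omega> in M. Z (Suc n) \<omega> = s \<bar> \<forall>i\<in>{1..n}. Z i \<omega> = z i) = P $ z n $ s"

definition latent_algebra :: "'w measure \<Rightarrow> (nat \<Rightarrow> 'w \<Rightarrow> 's) \<Rightarrow> 'w measure" where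
  "latent_algebra M Z = sigma (space M) {Z n -` B \<inter> space M | n B. n \<ge> 1}"

definition prob_given_latent ::
    "'w measure \<Rightarrow> (nat \<Rightarrow> 'w \<Rightarrow> 's) \<Rightarrow> ('w \<Rightarrow> bool) \<Rightarrow> 'w \<Rightarrow> real" where
  "prob_given_latent M Z Q =
     real_cond_exp M (latent_algebra M Z) (indicator {\<omega> \<in> space M. Q \<omega>})"

text \<open>\<open>e s\<close> is the emission distribution of the latent state \<open>s\<close>.  Conditional independence and
  the conditional law of the pairs are both relative to the whole latent path.\<close>

locale hidden_markov_model = finite_markov_chain M Z \<mu> P
  for M :: "'w measure"
    and Z :: "nat \<Rightarrow> 'w \<Rightarrow> 's::finite"
    and X Y :: "nat \<Rightarrow> 'w \<Rightarrow> 'a::finite"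
    and \<mu> :: "real ^ 's"
    and P :: "real ^ 's ^ 's"
    and e :: "'s \<Rightarrow> ('a \<times> 'a) pmf" +
  assumes X_measurable: "\<And>n. n \<ge> 1 \<Longrightarrow> X n \<in> measurable M (count_space UNIV)"
    and Y_measurable: "\<And>n. n \<ge> 1 \<Longrightarrow> Y n \<in> measurable M (count_space UNIV)"
    and cond_indep: "\<And>I B. finite I \<Longrightarrow> I \<subseteq> {1..} \<Longrightarrow>
      AE \<omega> in M. prob_given_latent M Z (\<lambda>\<omega>. \<forall>i\<in>I. (X i \<omega>, Y i \<omega>) \<in> B i) \<omega>
        = (\<Prod>i\<in>I. prob_given_latent M Z (\<lambda>\<omega>. (X i \<omega>, Y i \<omega>) \<in> B i) \<omega>)"
    and emission: "\<And>n B. n \<ge> 1 \<Longrightarrow>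
      AE \<omega> in M. prob_given_latent M Z (\<lambda>\<omega>. (X n \<omega>, Y n \<omega>) \<in> B) \<omega>
        = measure_pmf.prob (e (Z n \<omega>)) B"

text \<open>For \<open>\<P>(Z i = z) = 0\<close> both sides are \<open>0\<close> by the convention on division by zero.\<close>

definition symmetric_emissions ::
    "'w measure \<Rightarrow> (nat \<Rightarrow> 'w \<Rightarrow> 's) \<Rightarrow> (nat \<Rightarrow> 'w \<Rightarrow> 'a) \<Rightarrow> (nat \<Rightarrow> 'w \<Rightarrow> 'a) \<Rightarrow> bool" where
  "symmetric_emissions M Z X Y \<longleftrightarrow> (\<forall>i\<ge>1. \<forall>x y z.
     \<P>(\<omega> in M. X i \<omega> = x \<and> Y i \<omega> = y \<bar> Z i \<omega> = z) = \<P>(\<omega> in M. X i \<omega> = y \<and> Y i \<omega> = x \<bar> Z i \<omega> = z))"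


section \<open>Longest common subsequences\<close>

definition lcs_length :: "nat \<Rightarrow> (nat \<Rightarrow> 'a) \<Rightarrow> (nat \<Rightarrow> 'a) \<Rightarrow> nat" where
  "lcs_length n x y = Max {k. \<exists>i j :: nat \<Rightarrow> nat.
     strict_mono_on {1..k} i \<and> i ` {1..k} \<subseteq> {1..n} \<and>
     strict_mono_on {1..k} j \<and> j ` {1..k} \<subseteq> {1..n} \<and>
     (\<forall>s\<in>{1..k}. x (i s) = y (j s))}"

definition expected_LC ::
    "'w measure \<Rightarrow> (nat \<Rightarrow> 'w \<Rightarrow> 'a) \<Rightarrow> (nat \<Rightarrow> 'w \<Rightarrow> 'a) \<Rightarrow> nat \<Rightarrow> real" where
  "expected_LC M X Y n =
     prob_space.expectation M (\<lambda>\<omega>. real (lcs_length n (\<lambda>i. X i \<omega>) (\<lambda>i. Y i \<omega>)))"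

definition gamma_star ::
    "'w measure \<Rightarrow> (nat \<Rightarrow> 'w \<Rightarrow> 'a) \<Rightarrow> (nat \<Rightarrow> 'w \<Rightarrow> 'a) \<Rightarrow> real" where
  "gamma_star M X Y = lim (\<lambda>n. expected_LC M X Y n / real n)"


section \<open>Mixing coefficients\<close>

definition word :: "(nat \<Rightarrow> 'w \<Rightarrow> 'a) \<Rightarrow> nat \<Rightarrow> 'w \<Rightarrow> 'a list" where
  "word X n \<omega> = map (\<lambda>i. X i \<omega>) [1..<Suc n]"

definition beta_mixing ::
    "'w measure \<Rightarrow> (nat \<Rightarrow> 'w \<Rightarrow> 'a) \<Rightarrow> (nat \<Rightarrow> 'w \<Rightarrow> 'a) \<Rightarrow> nat \<Rightarrow> real" where
  "beta_mixing M X Y n = 1 / 2 * (\<Sum>u | length u = n. \<Sum>v | length v = n.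
     \<bar>\<P>(\<omega> in M. word X n \<omega> = u \<and> word Y n \<omega> = v)
       - \<P>(\<omega> in M. word X n \<omega> = u) * \<P>(\<omega> in M. word Y n \<omega> = v)\<bar>)"

definition beta_star ::
    "'w measure \<Rightarrow> (nat \<Rightarrow> 'w \<Rightarrow> 'a) \<Rightarrow> (nat \<Rightarrow> 'w \<Rightarrow> 'a) \<Rightarrow> real" where
  "beta_star M X Y = lim (beta_mixing M X Y)"

end

theory Submission
  imports Defs "HOL-Library.Sublist"
begin

text \<open>
Let \<open>a n\<close> be the expected length of the longest common subsequence for the stationary chain.
Placing alignments one after the other shows that \<open>a\<close> is superadditive, so \<open>a n / n\<close>
converges to its supremum \<open>\<gamma>\<close>. This is the upper bound for \<open>\<mu> = \<pi>\<close>,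
without any error term.

For the lower bound at \<open>m\<close>, consider words of length \<open>m K\<close> with \<open>K\<close>
large. An optimal alignment is a grid path, and cutting it at the antidiagonals \<open>x + y = j m\<close>
gives \<open>2 K\<close> pairs of pieces, each with \<open>m\<close> letters altogether, at the cost of at
most \<open>2 K\<close> matches (\<open>lcs_le_cut_score\<close>). This is the term \<open>2 / m\<close>. For
a fixed cut the two words are replaced by independent ones, which costs \<open>\<beta>\<close>, the limit of
the mixing coefficients, per letter. For independent stationary words with equal laws, comparing
\<open>p\<close> letters with \<open>q\<close> letters is worth as much as comparing \<open>q\<close> letters
with \<open>p\<close> letters, and concatenating both bounds each by half of a comparison of
\<open>p + q = m\<close> letters with \<open>m\<close> letters (\<open>indep_LC_le_half\<close>). Returning to
the true joint law costs \<open>\<beta>\<close> per letter once more. So every fixed cut has mean at most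
\<open>K * a m + 2 m K \<beta>\<close>.

The number of cuts is at most \<open>(m + 1) ^ (2 K)\<close>, and a cut score changes by at most two if one
emitted pair changes. The latent chain forgets its state at a geometric rate, so such functions are
subgaussian with variance proxy proportional to \<open>m K\<close> (\<open>E_exp_moment\<close>). The best cut
therefore exceeds the mean bound by at most a constant times \<open>m K * sqrt (ln m / m)\<close>. Dividing by
\<open>m K\<close> and letting \<open>K\<close> grow proves the bound for the stationary chain
(\<open>stationary_rate\<close>).

For another initial distribution \<open>\<mu>\<close>, dropping the first \<open>sqrt n\<close> letters
changes the expectation by at most \<open>sqrt n\<close>, and by then the chain is stationary up to total
variation distance \<open>c * \<alpha> powr sqrt n\<close> (\<open>LC_minus_stationary_LC_sqrt\<close>); in
particular the limit \<open>\<gamma>\<close> is the same. The mixing coefficient of the stationary chain is at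
most the limit for the chain started in \<open>\<mu>\<close>, since late windows of the latter have almost the
stationary law (\<open>mixing_stationary_le\<close>).
\<close>

section \<open>Longest common subsequences of lists\<close>

definition lcs :: "'a list \<Rightarrow> 'a list \<Rightarrow> nat" where
  "lcs xs ys = Max {length w | w. subseq w xs \<and> subseq w ys}"

lemma finite_common_subseq_lengths: "finite {length w | w. subseq w xs \<and> subseq w ys}"
  by (rule finite_subset[of _ "{..length xs}"]) (auto dest: list_emb_length)

lemma length_le_lcs: "subseq w xs \<Longrightarrow> subseq w ys \<Longrightarrow> length w \<le> lcs xs ys"
  unfolding lcs_def by (rule Max_ge[OF finite_common_subseq_lengths]) auto

lemma lcs_witness:
  obtains w where "subseq w xs" "subseq w ys" "length w = lcs xs ys"
proof -
  have "lcs xs ys \<in> {length w | w. subseq w xs \<and> subseq w ys}"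
    unfolding lcs_def by (rule Max_in[OF finite_common_subseq_lengths]) (auto intro: exI[of _ "[]"])
  then show ?thesis using that by auto
qed

lemma lcs_commute: "lcs xs ys = lcs ys xs"
  unfolding lcs_def by (rule arg_cong[of _ _ Max]) auto

lemma lcs_le_length: "lcs xs ys \<le> length xs"
  by (metis lcs_witness list_emb_length)

lemma lcs_map_le_length: "lcs (map f l) (map g l) \<le> length l"
  by (metis lcs_le_length length_map)

lemma lcs_mono: "subseq xs xs' \<Longrightarrow> subseq ys ys' \<Longrightarrow> lcs xs ys \<le> lcs xs' ys'"
  by (metis length_le_lcs lcs_witness subseq_order.order_trans)

lemma lcs_append_superadditive: "lcs xs ys + lcs xs' ys' \<le> lcs (xs @ xs') (ys @ ys')"
proof -
  obtain w where w: "subseq w xs" "subseq w ys" "length w = lcs xs ys" by (rule lcs_witness)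
  obtain v where v: "subseq v xs'" "subseq v ys'" "length v = lcs xs' ys'" by (rule lcs_witness)
  have "length (w @ v) \<le> lcs (xs @ xs') (ys @ ys')"
    by (intro length_le_lcs list_emb_append_mono w v)
  then show ?thesis using w v by simp
qed

lemma lcs_take_drop_superadditive:
  "lcs (take p xs) (take q ys) + lcs (drop p xs) (drop q ys) \<le> lcs xs ys"
  using lcs_append_superadditive[of "take p xs" "take q ys" "drop p xs" "drop q ys"] by simp

lemma subseq_tl: "subseq w (x # xs) \<Longrightarrow> subseq (tl w) xs"
  by (cases w) (auto simp: list_emb_Cons_iff2 subseq_Cons' split: if_splits)

lemma subseq_drop: "subseq w xs \<Longrightarrow> subseq (drop m w) (drop m xs)"
proof (induction m arbitrary: w xs)
  case (Suc m)
  show ?case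
  proof (cases xs)
    case Nil
    with Suc.prems have "w = []" by (metis list_emb_Nil2)
    then show ?thesis by simp
  next
    case (Cons x xs')
    then show ?thesis using Suc by (auto simp: drop_Suc dest: subseq_tl)
  qed
qed simp

text \<open>A letter of either word takes part in at most one match, and the matches with an endpoint among
the first \<open>m\<close> letters of either word are initial ones, so there are at most \<open>m\<close> of
them and not \<open>2 m\<close>.\<close>
lemma lcs_le_add_lcs_drop: "lcs xs ys \<le> m + lcs (drop m xs) (drop m ys)"
proof -
  obtain w where w: "subseq w xs" "subseq w ys" "length w = lcs xs ys" by (rule lcs_witness)
  have "length (drop m w) \<le> lcs (drop m xs) (drop m ys)"
    by (intro length_le_lcs subseq_drop w)
  then show ?thesis using w(3) by simp
qed

lemma lcs_change_one: "lcs (u @ x # v) ys \<le> lcs (u @ x' # v) ys + 1"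
proof -
  obtain w where w: "subseq w (u @ x # v)" "subseq w ys" "length w = lcs (u @ x # v) ys"
    by (rule lcs_witness)
  obtain w1 w2 where w12: "w = w1 @ w2" "subseq w1 u" "subseq w2 (x # v)"
    using w(1) by (auto simp: subseq_append_iff)
  have "subseq (w1 @ tl w2) (u @ x' # v)"
    using w12 by (intro list_emb_append_mono) (auto dest: subseq_tl)
  moreover have "subseq (w1 @ tl w2) ys"
    using w(2) w12(1) by (metis subseq_order.order_trans subseq_append' suffix_imp_subseq suffix_tl)
  ultimately have "length (w1 @ tl w2) \<le> lcs (u @ x' # v) ys" by (rule length_le_lcs)
  then show ?thesis using w(3) w12(1) by (cases w2) auto
qed

text \<open>An alignment is a monotone path in the grid from \<open>(0, 0)\<close> to
\<open>(length xs, length ys)\<close>. Cutting it at the point \<open>(p, q)\<close> where it meets the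
antidiagonal \<open>p + q = t\<close> costs nothing, unless a match, which raises \<open>p + q\<close> by two,
jumps over the antidiagonal; then that single match is lost.\<close>
lemma subseq_common_cut:
  assumes "subseq w xs" "subseq w ys" "t \<le> length xs + length ys"
  shows "\<exists>p q w1 w2. p + q = t \<and> p \<le> length xs \<and> q \<le> length ys \<and>
    subseq w1 (take p xs) \<and> subseq w1 (take q ys) \<and>
    subseq w2 (drop p xs) \<and> subseq w2 (drop q ys) \<and> length w \<le> length w1 + length w2 + 1"
  using assms
proof (induction "length xs + length ys" arbitrary: w xs ys t rule: less_induct)
  case less
  show ?case
  proof (cases "t = 0 \<or> w = []")
    case True
    then show ?thesis
    proof
      assume "t = 0"
      then show ?thesis using less.prems by (intro exI[of _ 0] exI[of _ "[]"] exI[of _ w]) auto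
    next
      assume "w = []"
      moreover have "\<exists>p q. p + q = t \<and> p \<le> length xs \<and> q \<le> length ys"
        using less.prems(3) by (intro exI[of _ "min t (length xs)"] exI[of _ "t - min t (length xs)"]) auto
      ultimately show ?thesis by (metis list.size(3) list_emb_Nil zero_le)
    qed
  next
    case False
    then obtain c w' where cw: "w = c # w'" by (cases w) auto
    obtain t' where t: "t = Suc t'" using False by (cases t) auto
    obtain x xs' where xs: "xs = x # xs'" using less.prems(1) cw by (cases xs) auto
    obtain y ys' where ys: "ys = y # ys'" using less.prems(2) cw by (cases ys) auto
    consider "subseq w xs'" | "subseq w ys'" | "x = c" "y = c" "subseq w' xs'" "subseq w' ys'"
      using less.prems cw xs ys by (auto split: if_splits)
    then show ?thesis
    proof cases
      case 1
      have "\<exists>p q w1 w2. p + q = t' \<and> p \<le> length xs' \<and> q \<le> length ys \<and>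
        subseq w1 (take p xs') \<and> subseq w1 (take q ys) \<and>
        subseq w2 (drop p xs') \<and> subseq w2 (drop q ys) \<and> length w \<le> length w1 + length w2 + 1"
        using less.prems 1 xs t by (intro less.hyps) auto
      then obtain p q w1 w2 where *: "p + q = t'" "p \<le> length xs'" "q \<le> length ys"
        "subseq w1 (take p xs')" "subseq w1 (take q ys)"
        "subseq w2 (drop p xs')" "subseq w2 (drop q ys)" "length w \<le> length w1 + length w2 + 1"
        by blast
      then show ?thesis using xs t
        by (intro exI[of _ "Suc p"] exI[of _ q] exI[of _ w1] exI[of _ w2]) auto
    next
      case 2
      have "\<exists>p q w1 w2. p + q = t' \<and> p \<le> length xs \<and> q \<le> length ys' \<and>
        subseq w1 (take p xs) \<and> subseq w1 (take q ys') \<and>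
        subseq w2 (drop p xs) \<and> subseq w2 (drop q ys') \<and> length w \<le> length w1 + length w2 + 1"
        using less.prems 2 ys t by (intro less.hyps) auto
      then obtain p q w1 w2 where *: "p + q = t'" "p \<le> length xs" "q \<le> length ys'"
        "subseq w1 (take p xs)" "subseq w1 (take q ys')"
        "subseq w2 (drop p xs)" "subseq w2 (drop q ys')" "length w \<le> length w1 + length w2 + 1"
        by blast
      then show ?thesis using ys t
        by (intro exI[of _ p] exI[of _ "Suc q"] exI[of _ w1] exI[of _ w2]) auto
    next
      case 3
      show ?thesis
      proof (cases t')
        case 0
        \<comment> \<open>The match of \<open>x\<close> with \<open>y\<close> jumps over the antidiagonal.\<close>
        show ?thesis using 3 0 xs ys t cw
          by (intro exI[of _ 1] exI[of _ 0] exI[of _ "[]"] exI[of _ w']) auto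
      next
        case (Suc t'')
        have "\<exists>p q w1 w2. p + q = t'' \<and> p \<le> length xs' \<and> q \<le> length ys' \<and>
          subseq w1 (take p xs') \<and> subseq w1 (take q ys') \<and>
          subseq w2 (drop p xs') \<and> subseq w2 (drop q ys') \<and> length w' \<le> length w1 + length w2 + 1"
          using less.prems 3 xs ys t Suc by (intro less.hyps) auto
        then obtain p q w1 w2 where *: "p + q = t''" "p \<le> length xs'" "q \<le> length ys'"
          "subseq w1 (take p xs')" "subseq w1 (take q ys')"
          "subseq w2 (drop p xs')" "subseq w2 (drop q ys')" "length w' \<le> length w1 + length w2 + 1"
          by blast
        then show ?thesis using 3 xs ys t Suc cw
          by (intro exI[of _ "Suc p"] exI[of _ "Suc q"] exI[of _ "c # w1"] exI[of _ w2]) auto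
      qed
    qed
  qed
qed

lemma lcs_cut:
  assumes "t \<le> length xs + length ys"
  obtains p q where "p + q = t" "p \<le> length xs" "q \<le> length ys"
    "lcs xs ys \<le> lcs (take p xs) (take q ys) + lcs (drop p xs) (drop q ys) + 1"
proof -
  obtain w where w: "subseq w xs" "subseq w ys" "length w = lcs xs ys" by (rule lcs_witness)
  from subseq_common_cut[OF w(1,2) assms] obtain p q w1 w2 where
    "p + q = t" "p \<le> length xs" "q \<le> length ys" "subseq w1 (take p xs)" "subseq w1 (take q ys)"
    "subseq w2 (drop p xs)" "subseq w2 (drop q ys)" "length w \<le> length w1 + length w2 + 1"
    by blast
  moreover from this have "length w1 \<le> lcs (take p xs) (take q ys)"
    "length w2 \<le> lcs (drop p xs) (drop q ys)" by (auto intro: length_le_lcs)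
  ultimately show ?thesis using that w(3) by fastforce
qed

text \<open>Both words are cut into consecutive pieces, and only the \<open>j\<close>-th pieces are compared
with each other. A piece of length \<open>p\<close> of \<open>xs\<close> is paired with a piece of length
\<open>m - p\<close> of \<open>ys\<close>: all pairs of pieces have total length \<open>m\<close>, so the list
of the lengths \<open>p\<close> determines the cut.\<close>
fun cut_score :: "nat \<Rightarrow> nat list \<Rightarrow> 'a list \<Rightarrow> 'a list \<Rightarrow> nat" where
  "cut_score m [] xs ys = 0"
| "cut_score m (p # ps) xs ys =
     lcs (take p xs) (take (m - p) ys) + cut_score m ps (drop p xs) (drop (m - p) ys)"

definition cuts :: "nat \<Rightarrow> nat \<Rightarrow> nat \<Rightarrow> nat list set" where
  "cuts m K n = {ps. length ps = K \<and> set ps \<subseteq> {..m} \<and> sum_list ps = n}"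

text \<open>The logarithm of this count is the entropy that competes with the concentration of each single cut
score.\<close>
lemma finite_cuts: "finite (cuts m K n)" and card_cuts_le: "card (cuts m K n) \<le> (m + 1) ^ K"
proof -
  have sub: "cuts m K n \<subseteq> {ps. set ps \<subseteq> {..m} \<and> length ps = K}" by (auto simp: cuts_def)
  have fin: "finite {ps. set ps \<subseteq> {..m} \<and> length ps = K}" by (rule finite_lists_length_eq) simp
  show "finite (cuts m K n)" by (rule finite_subset[OF sub fin])
  show "card (cuts m K n) \<le> (m + 1) ^ K"
    using card_mono[OF fin sub] card_lists_length_eq[of "{..m}" K] by simp
qed

lemma lcs_le_cut_score:
  assumes "length xs + length ys = m * K"
  shows "\<exists>ps\<in>cuts m K (length xs). lcs xs ys \<le> cut_score m ps xs ys + K"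
  using assms
proof (induction K arbitrary: xs ys)
  case 0
  then show ?case using lcs_le_length[of xs ys] by (auto simp: cuts_def)
next
  case (Suc K)
  obtain p q where pq: "p + q = m" "p \<le> length xs" "q \<le> length ys"
    "lcs xs ys \<le> lcs (take p xs) (take q ys) + lcs (drop p xs) (drop q ys) + 1"
    using lcs_cut[of m xs ys] Suc.prems by auto
  have "\<exists>ps\<in>cuts m K (length (drop p xs)).
      lcs (drop p xs) (drop q ys) \<le> cut_score m ps (drop p xs) (drop q ys) + K"
    using Suc.prems pq by (intro Suc.IH) auto
  then obtain ps where ps: "ps \<in> cuts m K (length (drop p xs))"
    "lcs (drop p xs) (drop q ys) \<le> cut_score m ps (drop p xs) (drop q ys) + K" by blast
  have "q = m - p" using pq(1) by auto
  with ps pq show ?case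
    by (intro bexI[of _ "p # ps"]) (auto simp: cuts_def)
qed

lemma cut_score_change_left:
  "cut_score m ps (u @ x # v) ys \<le> cut_score m ps (u @ x' # v) ys + 1"
proof (induction ps arbitrary: u ys)
  case (Cons p ps)
  show ?case
  proof (cases "p \<le> length u")
    case True
    then show ?thesis using Cons.IH[of "drop p u" "drop (m - p) ys"] by simp
  next
    case False
    then obtain d where d: "p = length u + Suc d" by (metis add_Suc_right less_imp_Suc_add not_le)
    show ?thesis
      using lcs_change_one[of u x "take d v" "take (m - p) ys" x'] d by simp
  qed
qed simp

lemma cut_score_change_right:
  "cut_score m ps xs (u @ y # v) \<le> cut_score m ps xs (u @ y' # v) + 1"
proof (induction ps arbitrary: u xs)
  case (Cons p ps)
  show ?case
  proof (cases "m - p \<le> length u")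
    case True
    then show ?thesis using Cons.IH[of "drop p xs" "drop (m - p) u"] by simp
  next
    case False
    then obtain d where d: "m - p = length u + Suc d"
      by (metis add_Suc_right less_imp_Suc_add not_le)
    show ?thesis
      using lcs_change_one[of u y "take d v" "take p xs" y'] d
      by (simp add: lcs_commute[of "take p xs"])
  qed
qed simp

lemma cut_score_le_length: "cut_score m ps xs ys \<le> length xs"
proof (induction ps arbitrary: xs ys)
  case (Cons p ps)
  show ?case using Cons[of "drop p xs" "drop (m - p) ys"]
      lcs_le_length[of "take p xs" "take (m - p) ys"] by auto
qed simp

text \<open>Lists replace pairs of increasing index maps from here on: the values along such maps form a
common subsequence, and conversely the positions of a subsequence form an increasing index map.\<close>
lemma lcs_length_eq_lcs: "lcs_length n x y = lcs (map x [1..<Suc n]) (map y [1..<Suc n])"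
proof -
  have "(\<exists>i j :: nat \<Rightarrow> nat.
     strict_mono_on {1..k} i \<and> i ` {1..k} \<subseteq> {1..n} \<and>
     strict_mono_on {1..k} j \<and> j ` {1..k} \<subseteq> {1..n} \<and> (\<forall>s\<in>{1..k}. x (i s) = y (j s))) \<longleftrightarrow>
     (\<exists>w. k = length w \<and> subseq w (map x [1..<Suc n]) \<and> subseq w (map y [1..<Suc n]))" for k
  proof
    assume "\<exists>i j :: nat \<Rightarrow> nat.
     strict_mono_on {1..k} i \<and> i ` {1..k} \<subseteq> {1..n} \<and>
     strict_mono_on {1..k} j \<and> j ` {1..k} \<subseteq> {1..n} \<and> (\<forall>s\<in>{1..k}. x (i s) = y (j s))"
    then obtain i j :: "nat \<Rightarrow> nat" where ij: "strict_mono_on {1..k} i" "i ` {1..k} \<subseteq> {1..n}"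
      "strict_mono_on {1..k} j" "j ` {1..k} \<subseteq> {1..n}" "\<forall>s\<in>{1..k}. x (i s) = y (j s)" by blast
    have sub: "subseq (map f [1..<Suc k]) [1..<Suc n]"
      if "strict_mono_on {1..k} f" "f ` {1..k} \<subseteq> {1..n}" for f :: "nat \<Rightarrow> nat"
    proof (rule sorted_subset_imp_subseq)
      show "set (map f [1..<Suc k]) \<subseteq> set [1..<Suc n]" using that(2) by fastforce
      show "sorted_wrt (<) (map f [1..<Suc k])"
        using that(1) by (auto simp: sorted_wrt_iff_nth_less strict_mono_on_def simp del: upt_Suc)
      show "sorted [1..<Suc n]" by (rule sorted_upt)
    qed
    have "subseq (map x (map i [1..<Suc k])) (map x [1..<Suc n])"
      "subseq (map y (map j [1..<Suc k])) (map y [1..<Suc n])"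
      by (rule subseq_map[OF sub[OF ij(1,2)]], rule subseq_map[OF sub[OF ij(3,4)]])
    moreover have "map x (map i [1..<Suc k]) = map y (map j [1..<Suc k])"
      using ij(5) by (auto simp del: upt_Suc)
    ultimately have "subseq (map x (map i [1..<Suc k])) (map x [1..<Suc n])"
      "subseq (map x (map i [1..<Suc k])) (map y [1..<Suc n])" by (simp_all only:)
    moreover have "k = length (map x (map i [1..<Suc k]))" by (simp del: upt_Suc)
    ultimately show "\<exists>w. k = length w \<and> subseq w (map x [1..<Suc n]) \<and> subseq w (map y [1..<Suc n])"
      by blast
  next
    assume "\<exists>w. k = length w \<and> subseq w (map x [1..<Suc n]) \<and> subseq w (map y [1..<Suc n])"
    then obtain w where w: "k = length w" "subseq w (map x [1..<Suc n])" "subseq w (map y [1..<Suc n])"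
      by blast
    have ex: "\<exists>i :: nat \<Rightarrow> nat. strict_mono_on {1..k} i \<and> i ` {1..k} \<subseteq> {1..n} \<and>
        (\<forall>s\<in>{1..k}. f (i s) = w ! (s - 1))"
      if w_sub: "subseq w (map f [1..<Suc n])" for f
    proof -
      obtain N where "w = nths (map f [1..<Suc n]) N"
        using w_sub unfolding subseq_conv_nths by blast
      then have N: "w = map f (nths [1..<Suc n] N)" by (simp only: nths_map)
      define r where "r = nths [1..<Suc n] N"
      have len: "length r = k" using N w(1) r_def by simp
      have sorted: "sorted_wrt (<) r" unfolding r_def
        by (metis sorted_wrt_upt strict_sorted_iff sorted_nths distinct_nthsI)
      have set: "set r \<subseteq> {1..n}" unfolding r_def using set_nths_subset[of "[1..<Suc n]" N] by auto
      show ?thesis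
      proof (intro exI[of _ "\<lambda>s. r ! (s - 1)"] conjI ballI)
        show "strict_mono_on {1..k} (\<lambda>s. r ! (s - 1))"
          using sorted len by (auto simp: strict_mono_on_def sorted_wrt_iff_nth_less)
        show "(\<lambda>s. r ! (s - 1)) ` {1..k} \<subseteq> {1..n}"
        proof (rule image_subsetI)
          fix s assume "s \<in> {1..k}"
          then have "s - 1 < length r" using len by auto
          then show "r ! (s - 1) \<in> {1..n}" using set nth_mem by blast
        qed
        show "f (r ! (s - 1)) = w ! (s - 1)" if "s \<in> {1..k}" for s
          using that len N r_def by auto
      qed
    qed
    show "\<exists>i j :: nat \<Rightarrow> nat.
     strict_mono_on {1..k} i \<and> i ` {1..k} \<subseteq> {1..n} \<and>
     strict_mono_on {1..k} j \<and> j ` {1..k} \<subseteq> {1..n} \<and> (\<forall>s\<in>{1..k}. x (i s) = y (j s))"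
      using ex[OF w(2)] ex[OF w(3)] by metis
  qed
  then show ?thesis unfolding lcs_length_def lcs_def by simp
qed

section \<open>Total variation distance and stochastic matrices\<close>

text \<open>A signed measure of total mass zero does not see constants, so the test function may be centred at
the middle of its range, which gains the factor one half.\<close>
lemma sum_mult_le_oscillation:
  fixes d W :: "'i \<Rightarrow> real"
  assumes "sum d A = 0" and "\<And>i. i \<in> A \<Longrightarrow> a \<le> W i \<and> W i \<le> a + R"
  shows "\<bar>\<Sum>i\<in>A. d i * W i\<bar> \<le> R * ((\<Sum>i\<in>A. \<bar>d i\<bar>) / 2)"
proof -
  have "(\<Sum>i\<in>A. d i * W i) = (\<Sum>i\<in>A. d i * (W i - (a + R / 2)))"
    using assms(1) by (simp add: right_diff_distrib sum_subtractf flip: sum_distrib_right)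
  also have "\<bar>\<dots>\<bar> \<le> (\<Sum>i\<in>A. \<bar>d i\<bar> * (R / 2))"
  proof (rule order.trans[OF sum_abs sum_mono])
    fix i assume "i \<in> A"
    then have "\<bar>W i - (a + R / 2)\<bar> \<le> R / 2" using assms(2)[of i] by linarith
    then show "\<bar>d i * (W i - (a + R / 2))\<bar> \<le> \<bar>d i\<bar> * (R / 2)"
      by (simp only: abs_mult mult_left_mono abs_ge_zero)
  qed
  also have "\<dots> = R * ((\<Sum>i\<in>A. \<bar>d i\<bar>) / 2)"
    by (simp only: sum_distrib_right[symmetric]) simp
  finally show ?thesis .
qed

definition tv_dist :: "real ^ 's::finite \<Rightarrow> real ^ 's \<Rightarrow> real" where
  "tv_dist \<nu> \<rho> = (\<Sum>s\<in>UNIV. \<bar>\<nu> $ s - \<rho> $ s\<bar>) / 2"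

lemma tv_dist_nonneg: "0 \<le> tv_dist \<nu> \<rho>"
  by (simp add: tv_dist_def sum_nonneg)

lemma tv_dist_le_1:
  assumes "probability_vector \<nu>" "probability_vector \<rho>"
  shows "tv_dist \<nu> \<rho> \<le> 1"
proof -
  have "(\<Sum>s\<in>UNIV. \<bar>\<nu> $ s - \<rho> $ s\<bar>) \<le> (\<Sum>s\<in>UNIV. \<nu> $ s + \<rho> $ s)"
  proof (rule sum_mono)
    fix s show "\<bar>\<nu> $ s - \<rho> $ s\<bar> \<le> \<nu> $ s + \<rho> $ s"
      using assms by (auto simp: probability_vector_def abs_le_iff add.commute intro: order.trans[of _ 0])
  qed
  then show ?thesis using assms by (simp add: tv_dist_def sum.distrib probability_vector_def)
qed

lemma expectation_diff_le_tv_dist: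
  assumes "probability_vector \<nu>" "probability_vector \<rho>" and "\<And>s. a \<le> W s \<and> W s \<le> a + R"
  shows "\<bar>(\<Sum>s\<in>UNIV. \<nu> $ s * W s) - (\<Sum>s\<in>UNIV. \<rho> $ s * W s)\<bar> \<le> R * tv_dist \<nu> \<rho>"
proof -
  have "\<bar>\<Sum>s\<in>UNIV. (\<nu> $ s - \<rho> $ s) * W s\<bar> \<le> R * ((\<Sum>s\<in>UNIV. \<bar>\<nu> $ s - \<rho> $ s\<bar>) / 2)"
    by (rule sum_mult_le_oscillation)
       (use assms in \<open>auto simp: sum_subtractf probability_vector_def\<close>)
  then show ?thesis by (simp add: tv_dist_def left_diff_distrib sum_subtractf)
qed

lemma oscillation_interval:
  fixes W :: "'s::finite \<Rightarrow> real"
  assumes "\<And>s t. \<bar>W s - W t\<bar> \<le> R"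
  shows "Min (range W) \<le> W s \<and> W s \<le> Min (range W) + R"
proof -
  have "Min (range W) \<in> range W" by (rule Min_in) auto
  then obtain t where "Min (range W) = W t" by (rule imageE)
  moreover have "Min (range W) \<le> W s" by (rule Min_le) auto
  ultimately show ?thesis using assms[of s t] by auto
qed

lemma vector_matrix_nth: "(v v* A) $ t = (\<Sum>s\<in>UNIV. v $ s * A $ s $ t)" for A :: "real^'n^'m"
  by (simp add: vector_matrix_mult_def mult.commute)

lemma probability_vector_mult:
  assumes "probability_vector \<nu>" "stochastic_matrix Q"
  shows "probability_vector (\<nu> v* Q)"
proof -
  have "(\<Sum>t\<in>UNIV. \<Sum>s\<in>UNIV. \<nu> $ s * Q $ s $ t) = (\<Sum>s\<in>UNIV. \<nu> $ s * (\<Sum>t\<in>UNIV. Q $ s $ t))"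
    by (subst sum.swap) (simp add: sum_distrib_left)
  then show ?thesis
    using assms by (auto simp: probability_vector_def stochastic_matrix_def vector_matrix_nth intro!: sum_nonneg)
qed

text \<open>Doeblin's argument: a constant \<open>\<delta>\<close> may be subtracted from all entries of
\<open>Q\<close> without affecting the difference of the two images, because \<open>\<nu> - \<rho>\<close> has
total mass zero. The remaining rows have mass at most \<open>1 - \<delta>\<close>. With
\<open>\<delta> = 0\<close> this says that stochastic matrices do not increase distances.\<close>
lemma tv_dist_contraction:
  fixes Q :: "real ^ 's::finite ^ 's"
  assumes "probability_vector \<nu>" "probability_vector \<rho>" "stochastic_matrix Q"
    and "0 \<le> \<delta>" "\<And>s t. \<delta> \<le> Q $ s $ t"
  shows "tv_dist (\<nu> v* Q) (\<rho> v* Q) \<le> (1 - \<delta>) * tv_dist \<nu> \<rho>"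
proof -
  let ?d = "\<lambda>s. \<nu> $ s - \<rho> $ s"
  have d0: "sum ?d UNIV = 0" using assms(1,2) by (simp add: sum_subtractf probability_vector_def)
  have row: "(\<Sum>t\<in>UNIV. Q $ s $ t - \<delta>) \<le> 1 - \<delta>" for s
  proof -
    have "\<delta> * 1 \<le> \<delta> * real CARD('s)"
      using assms(4) by (intro mult_left_mono) (auto simp: Suc_le_eq)
    then show ?thesis
      using assms(3) by (simp add: sum_subtractf stochastic_matrix_def probability_vector_def mult.commute)
  qed
  have "(\<Sum>t\<in>UNIV. \<bar>(\<nu> v* Q) $ t - (\<rho> v* Q) $ t\<bar>) = (\<Sum>t\<in>UNIV. \<bar>\<Sum>s\<in>UNIV. ?d s * (Q $ s $ t - \<delta>)\<bar>)"
  proof (rule sum.cong[OF refl])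
    fix t
    have "(\<Sum>s\<in>UNIV. ?d s * (Q $ s $ t - \<delta>)) = (\<Sum>s\<in>UNIV. ?d s * Q $ s $ t) - sum ?d UNIV * \<delta>"
      unfolding sum_distrib_right by (subst sum_subtractf[symmetric]) (simp only: right_diff_distrib)
    then show "\<bar>(\<nu> v* Q) $ t - (\<rho> v* Q) $ t\<bar> = \<bar>\<Sum>s\<in>UNIV. ?d s * (Q $ s $ t - \<delta>)\<bar>"
      using d0 by (simp add: vector_matrix_nth left_diff_distrib sum_subtractf)
  qed
  also have "\<dots> \<le> (\<Sum>t\<in>UNIV. \<Sum>s\<in>UNIV. \<bar>?d s\<bar> * (Q $ s $ t - \<delta>))"
    by (intro sum_mono order.trans[OF sum_abs]) (simp add: abs_mult assms(5))
  also have "\<dots> = (\<Sum>s\<in>UNIV. \<bar>?d s\<bar> * (\<Sum>t\<in>UNIV. Q $ s $ t - \<delta>))"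
    by (subst sum.swap) (simp add: sum_distrib_left)
  also have "\<dots> \<le> (\<Sum>s\<in>UNIV. \<bar>?d s\<bar> * (1 - \<delta>))"
    by (intro sum_mono mult_left_mono row) auto
  also have "\<dots> = (1 - \<delta>) * (\<Sum>s\<in>UNIV. \<bar>?d s\<bar>)" by (simp add: sum_distrib_left mult.commute)
  finally show ?thesis by (simp add: tv_dist_def)
qed

lemma matrix_power_add: "matrix_power P (n + m) = matrix_power P n ** matrix_power P m"
  by (induction n) (auto simp: matrix_mul_assoc)

lemma stochastic_matrix_mult:
  assumes "stochastic_matrix A" "stochastic_matrix B"
  shows "stochastic_matrix (A ** B)"
proof -
  have "(A ** B) $ s = A $ s v* B" for s
    by (simp add: vec_eq_iff matrix_matrix_mult_def vector_matrix_nth)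
  then show ?thesis using assms(1) probability_vector_mult[OF _ assms(2)]
    unfolding stochastic_matrix_def by simp
qed

lemma stochastic_matrix_power: "stochastic_matrix P \<Longrightarrow> stochastic_matrix (matrix_power P n)"
proof (induction n)
  case 0
  have "(\<Sum>t\<in>UNIV. mat 1 $ s $ t) = (1 :: real)" for s :: 'a
    by (simp add: mat_def)
  then show ?case by (simp add: stochastic_matrix_def probability_vector_def) (simp add: mat_def)
qed (simp add: stochastic_matrix_mult)

lemma stationary_matrix_power: "\<pi> v* P = \<pi> \<Longrightarrow> \<pi> v* matrix_power P n = \<pi>"
  for \<pi> :: "real ^ 's::finite"
  by (induction n) (auto simp flip: vector_matrix_mul_assoc)

lemma tv_dist_power_stationary_le:
  fixes P :: "real ^ 's::finite ^ 's"
  assumes "probability_vector \<nu>" "stationary_distribution P \<pi>" "stochastic_matrix P"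
    and "0 \<le> \<epsilon>" "\<epsilon> \<le> 1" "\<And>s t. \<epsilon> \<le> matrix_power P k $ s $ t"
  shows "tv_dist (\<nu> v* matrix_power P m) \<pi> \<le> (1 - \<epsilon>) ^ (m div k)"
proof -
  have \<pi>: "probability_vector \<pi>" "\<pi> v* P = \<pi>"
    using assms(2) by (auto simp: stationary_distribution_def)
  have P: "stochastic_matrix (matrix_power P n)" for n
    by (rule stochastic_matrix_power) fact
  have step: "tv_dist (\<nu> v* matrix_power P (q * k)) \<pi> \<le> (1 - \<epsilon>) ^ q" for q
  proof (induction q)
    case 0
    then show ?case using tv_dist_le_1[OF assms(1) \<pi>(1)] by simp
  next
    case (Suc q)
    have "tv_dist (\<nu> v* matrix_power P (q * k) v* matrix_power P k) (\<pi> v* matrix_power P k)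
        \<le> (1 - \<epsilon>) * tv_dist (\<nu> v* matrix_power P (q * k)) \<pi>"
      by (intro tv_dist_contraction probability_vector_mult assms P \<pi>)
    also have "\<dots> \<le> (1 - \<epsilon>) * (1 - \<epsilon>) ^ q"
      using Suc assms(5) by (intro mult_left_mono) auto
    finally show ?case
      using stationary_matrix_power[OF \<pi>(2)]
      by (simp add: vector_matrix_mul_assoc add.commute[of k] matrix_power_add)
  qed
  have m: "m = (m div k) * k + m mod k" by simp
  have "tv_dist (\<nu> v* matrix_power P ((m div k) * k) v* matrix_power P (m mod k)) (\<pi> v* matrix_power P (m mod k))
      \<le> (1 - 0) * tv_dist (\<nu> v* matrix_power P ((m div k) * k)) \<pi>"
    using P[of "m mod k"]
    by (intro tv_dist_contraction probability_vector_mult assms P \<pi>)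
       (auto simp: stochastic_matrix_def probability_vector_def)
  also have "\<dots> \<le> (1 - \<epsilon>) ^ (m div k)" using step by simp
  finally show ?thesis
    using stationary_matrix_power[OF \<pi>(2)]
    by (metis m vector_matrix_mul_assoc matrix_power_add)
qed

text \<open>Rounding \<open>sqrt n\<close> and then \<open>sqrt n / k\<close> down costs at most two factors
\<open>1 - \<epsilon>\<close>; the constant \<open>c\<close> pays for them.\<close>
lemma contraction_rate_sqrt:
  fixes \<epsilon> \<alpha> c :: real
  assumes "k \<ge> 1" "0 < \<epsilon>" "\<epsilon> < 1" "\<alpha> = (1 - \<epsilon>) powr (1 / real k)" "c = 1 / (1 - \<epsilon>)\<^sup>2"
  shows "(1 - \<epsilon>) ^ (nat \<lfloor>sqrt (real n)\<rfloor> div k) \<le> c * \<alpha> powr sqrt (real n)"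
proof -
  define m where "m = nat \<lfloor>sqrt (real n)\<rfloor>"
  define q where "q = m div k"
  have "sqrt (real n) < real m + 1" unfolding m_def by linarith
  moreover have "m < k + k * q"
    unfolding q_def using assms(1) by (intro dividend_less_times_div) simp
  then have "real m < real (k + k * q)" by (simp only: of_nat_less_iff)
  then have "real m < real k * (real q + 1)" by (simp add: algebra_simps)
  ultimately have "sqrt (real n) < real k * (real q + 1) + 1" by linarith
  also have "\<dots> \<le> real k * (real q + 2)" using assms(1) by (simp add: algebra_simps)
  finally have "sqrt (real n) / real k - 2 \<le> real q" using assms(1) by (simp add: field_simps)
  then have "(1 - \<epsilon>) powr real q \<le> (1 - \<epsilon>) powr (sqrt (real n) / real k - 2)"
    using assms(2,3) by (intro powr_mono') auto
  also have "\<dots> = c * \<alpha> powr sqrt (real n)"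
    using assms by (simp add: powr_diff powr_powr powr_realpow[of _ 2, simplified])
  finally show ?thesis using assms(3) by (simp add: powr_realpow m_def q_def)
qed

section \<open>Superadditive sequences and exponential moments\<close>

text \<open>Fekete's lemma, with the supremum of the ratios as the limit.\<close>
lemma superadditive_limit:
  fixes a :: "nat \<Rightarrow> real"
  assumes super: "\<And>n m. a n + a m \<le> a (n + m)" and bounds: "\<And>n. 0 \<le> a n" "\<And>n. a n \<le> real n"
  obtains L where "(\<lambda>n. a n / real n) \<longlonglongrightarrow> L" "\<And>n. n \<ge> 1 \<Longrightarrow> a n / real n \<le> L"
proof -
  define L where "L = (SUP n\<in>{1..}. a n / real n)"
  have bdd: "bdd_above ((\<lambda>n. a n / real n) ` {1..})"
    using bounds(2) by (intro bdd_aboveI[of _ 1]) (auto simp: field_simps)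
  have upper: "a n / real n \<le> L" if "n \<ge> 1" for n
    unfolding L_def by (rule cSUP_upper[OF _ bdd]) (use that in auto)
  have mult: "real q * a n \<le> a (q * n)" for q n
  proof (induction q)
    case (Suc q)
    then show ?case using super[of n "q * n"] by (simp add: algebra_simps)
  qed (use bounds(1)[of 0] in simp)
  have "(\<lambda>n. a n / real n) \<longlonglongrightarrow> L"
  proof (rule LIMSEQ_I)
    fix r :: real assume "r > 0"
    then obtain n0 where n0: "n0 \<ge> 1" "L - r / 2 < a n0 / real n0"
      using less_cSUP_iff[OF _ bdd, of "L - r / 2"] unfolding L_def by auto
    obtain N0 where N0: "real n0 / (r / 2) < real N0" using reals_Archimedean2 by blast
    show "\<exists>no. \<forall>n\<ge>no. norm (a n / real n - L) < r"
    proof (intro exI allI impI)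
      fix N assume "N \<ge> max N0 1"
      then have N: "N \<ge> N0" "N \<ge> 1" by auto
      define q where "q = N div n0"
      have "N < n0 + n0 * q"
        unfolding q_def using n0(1) by (intro dividend_less_times_div) simp
      then have "real N < real (n0 + n0 * q)" by (simp only: of_nat_less_iff)
      then have q: "real N - real n0 < real n0 * real q" by simp
      have "(a n0 / real n0) * (real N - real n0) \<le> (a n0 / real n0) * (real n0 * real q)"
        using q bounds(1)[of n0] by (intro mult_left_mono) auto
      also have "\<dots> = real q * a n0" using n0 by simp
      also have "\<dots> \<le> a (q * n0)" by (rule mult)
      also have "\<dots> \<le> a (q * n0) + a (N mod n0)" using bounds(1) by simp
      also have "\<dots> \<le> a N" using super[of "q * n0" "N mod n0"] by (simp add: q_def)
      finally have "(a n0 / real n0) * real N - a n0 \<le> a N" using n0(1) by (simp add: field_simps)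
      then have "((a n0 / real n0) * real N - a n0) / real N \<le> a N / real N"
        by (rule divide_right_mono) simp
      then have "a n0 / real n0 - a n0 / real N \<le> a N / real N"
        using N(2) by (simp add: diff_divide_distrib)
      moreover have "a n0 / real N \<le> real n0 / real N" using bounds(2) by (intro divide_right_mono) auto
      moreover have "real n0 / real N < r / 2"
      proof -
        have "real n0 < real N0 * (r / 2)" using N0 \<open>r > 0\<close> by (simp add: field_simps)
        also have "\<dots> \<le> real N * (r / 2)" using N(1) \<open>r > 0\<close> by (intro mult_right_mono) auto
        finally show ?thesis using N(2) by (simp add: field_simps)
      qed
      ultimately show "norm (a N / real N - L) < r" using upper[OF N(2)] n0(2)
        unfolding real_norm_def by linarith
    qed
  qed
  with upper that show ?thesis by blast
qed

text \<open>Hoeffding's lemma for a finitely supported distribution with weights \<open>p\<close>.\<close>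
lemma exp_moment_le_oscillation:
  fixes p h :: "'i::finite \<Rightarrow> real"
  assumes p: "\<And>i. 0 \<le> p i" "(\<Sum>i\<in>UNIV. p i) = 1"
    and h: "\<And>i j. \<bar>h i - h j\<bar> \<le> R" and l: "0 < l"
  shows "(\<Sum>i\<in>UNIV. p i * exp (l * h i)) \<le> exp (l * (\<Sum>i\<in>UNIV. p i * h i) + l\<^sup>2 * R\<^sup>2 / 8)"
proof -
  have nn: "(\<integral>\<^sup>+ x. ennreal (p x) \<partial>count_space UNIV) = 1"
    using p by (simp add: nn_integral_count_space_finite flip: ennreal_1)
  define q where "q = embed_pmf p"
  have q: "pmf q i = p i" for i
    unfolding q_def by (rule pmf_embed_pmf[OF p(1) nn])
  have E: "measure_pmf.expectation q g = (\<Sum>i\<in>UNIV. p i * g i)" for g :: "'i \<Rightarrow> real"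
    by (subst integral_measure_pmf_real[of UNIV]) (auto simp: q mult.commute)
  define b where "b = Min (range h)"
  interpret interval_bounded_random_variable "measure_pmf q" h b "b + R"
    by unfold_locales
       (use oscillation_interval[of h R, OF h] in \<open>auto simp: b_def\<close>)
  have "ennreal (measure_pmf.expectation q (\<lambda>x. exp (l * (h x - measure_pmf.expectation q h))))
      = nn_integral q (\<lambda>x. exp (l * (h x - measure_pmf.expectation q h)))"
    by (rule nn_integral_eq_integral[symmetric]) (auto intro!: integrable_measure_pmf_finite)
  also have "\<dots> \<le> ennreal (exp (l\<^sup>2 * (b + R - b)\<^sup>2 / 8))"
    using Hoeffdings_lemma_nn_integral[OF l]
    by (simp add: algebra_simps)
  finally have "(\<Sum>i\<in>UNIV. p i * exp (l * (h i - (\<Sum>i\<in>UNIV. p i * h i)))) \<le> exp (l\<^sup>2 * R\<^sup>2 / 8)"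
    by (simp add: E)
  then have "(\<Sum>i\<in>UNIV. p i * exp (l * h i)) / exp (l * (\<Sum>i\<in>UNIV. p i * h i)) \<le> exp (l\<^sup>2 * R\<^sup>2 / 8)"
    by (simp add: right_diff_distrib exp_diff sum_divide_distrib)
  then have "(\<Sum>i\<in>UNIV. p i * exp (l * h i)) \<le> exp (l\<^sup>2 * R\<^sup>2 / 8) * exp (l * (\<Sum>i\<in>UNIV. p i * h i))"
    by (simp add: pos_divide_le_eq)
  then show ?thesis by (simp only: exp_add mult.commute)
qed

section \<open>Expectations of functions of the emitted pairs\<close>

locale emission_kernel =
  fixes P :: "real ^ 's::finite ^ 's" and e :: "'s \<Rightarrow> ('a::finite \<times> 'a) pmf"
  assumes stochastic: "stochastic_matrix P"
begin

text \<open>\<open>E_from n s f\<close> is the expectation of \<open>f\<close> applied to the first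
\<open>n\<close> emitted pairs of a chain started in \<open>s\<close>, and \<open>E n \<nu> f\<close> the same
for the initial distribution \<open>\<nu>\<close>. All spaces are finite, so these are finite sums: no
integrability arises, the initial distribution can be varied freely, and a statement about every horizon
\<open>n\<close> and every \<open>f\<close> is accessible to induction on \<open>n\<close>. Conditioning on
the first pair \<open>z\<close> and the next state \<open>t\<close> is the recursion equation itself.\<close>
primrec E_from :: "nat \<Rightarrow> 's \<Rightarrow> (('a \<times> 'a) list \<Rightarrow> real) \<Rightarrow> real" where
  "E_from 0 s f = f []"
| "E_from (Suc n) s f =
     (\<Sum>z\<in>UNIV. pmf (e s) z * (\<Sum>t\<in>UNIV. P $ s $ t * E_from n t (\<lambda>l. f (z # l))))"

definition E :: "nat \<Rightarrow> real ^ 's \<Rightarrow> (('a \<times> 'a) list \<Rightarrow> real) \<Rightarrow> real" where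
  "E n \<nu> f = (\<Sum>s\<in>UNIV. \<nu> $ s * E_from n s f)"

lemma transition_nonneg: "0 \<le> P $ s $ t" and transition_sum: "(\<Sum>t\<in>UNIV. P $ s $ t) = 1"
  using stochastic by (auto simp: stochastic_matrix_def probability_vector_def)

lemma emission_sum: "(\<Sum>z\<in>UNIV. pmf (e s) z) = 1"
  by (rule sum_pmf_eq_1) auto

lemma E_from_cong:
  "(\<And>l. length l = n \<Longrightarrow> f l = g l) \<Longrightarrow> E_from n s f = E_from n s g"
proof (induction n arbitrary: s f g)
  case (Suc n)
  have "E_from n t (\<lambda>l. f (z # l)) = E_from n t (\<lambda>l. g (z # l))" for t z
    using Suc.prems by (intro Suc.IH) auto
  then show ?case by simp
qed simp

lemma E_from_mono:
  "(\<And>l. length l = n \<Longrightarrow> f l \<le> g l) \<Longrightarrow> E_from n s f \<le> E_from n s g"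
proof (induction n arbitrary: s f g)
  case (Suc n)
  have "E_from n t (\<lambda>l. f (z # l)) \<le> E_from n t (\<lambda>l. g (z # l))" for t z
    using Suc.prems by (intro Suc.IH) auto
  then show ?case by (auto intro!: sum_mono mult_left_mono transition_nonneg)
qed simp

lemma E_from_add: "E_from n s (\<lambda>l. f l + g l) = E_from n s f + E_from n s g"
  by (induction n arbitrary: s f g) (simp_all add: distrib_left sum.distrib)

lemma E_from_cmult: "E_from n s (\<lambda>l. c * f l) = c * E_from n s f"
  by (induction n arbitrary: s f) (simp_all add: sum_distrib_left mult.left_commute)

lemma E_from_const: "E_from n s (\<lambda>_. c) = c"
  by (induction n arbitrary: s)
     (simp_all add: transition_sum emission_sum flip: sum_distrib_right)

lemma E_from_take: "E_from (m + n) s (\<lambda>l. f (take m l)) = E_from m s f"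
proof (induction m arbitrary: s f)
  case (Suc m)
  show ?case using Suc.IH[of _ "\<lambda>l. f (z # l)" for z] by simp
qed (simp add: E_from_const)

text \<open>The Markov property: the emissions after time \<open>m\<close> are those of a chain started in the
state reached after \<open>m\<close> steps.\<close>
lemma E_from_drop:
  "E_from (m + n) s (\<lambda>l. f (drop m l)) = (\<Sum>t\<in>UNIV. matrix_power P m $ s $ t * E_from n t f)"
proof (induction m arbitrary: s)
  case 0
  have "(\<Sum>t\<in>UNIV. mat 1 $ s $ t * E_from n t f) = (\<Sum>t\<in>UNIV. if s = t then E_from n t f else 0)"
    by (rule sum.cong) (auto simp: mat_def)
  then show ?case by simp
next
  case (Suc m)
  have "E_from (Suc m + n) s (\<lambda>l. f (drop (Suc m) l)) =
      (\<Sum>t\<in>UNIV. P $ s $ t * (\<Sum>u\<in>UNIV. matrix_power P m $ t $ u * E_from n u f))"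
    by (simp add: Suc.IH emission_sum flip: sum_distrib_right)
  also have "\<dots> = (\<Sum>t\<in>UNIV. \<Sum>u\<in>UNIV. P $ s $ t * (matrix_power P m $ t $ u * E_from n u f))"
    by (simp add: sum_distrib_left)
  also have "\<dots> = (\<Sum>u\<in>UNIV. \<Sum>t\<in>UNIV. P $ s $ t * (matrix_power P m $ t $ u * E_from n u f))"
    by (rule sum.swap)
  finally show ?case
    by (simp add: matrix_matrix_mult_def sum_distrib_right mult.assoc)
qed

lemma E_from_swap:
  assumes "\<And>s x y. pmf (e s) (x, y) = pmf (e s) (y, x)"
  shows "E_from n s (\<lambda>l. f (map prod.swap l)) = E_from n s f"
proof (induction n arbitrary: s f)
  case (Suc n)
  have pmf_swap: "pmf (e s) z = pmf (e s) (prod.swap z)" for z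
    using assms[of s "fst z" "snd z"] by (simp add: prod.swap_def)
  let ?g = "\<lambda>z. pmf (e s) z * (\<Sum>t\<in>UNIV. P $ s $ t * E_from n t (\<lambda>l. f (z # l)))"
  have "E_from (Suc n) s (\<lambda>l. f (map prod.swap l)) = (\<Sum>z\<in>UNIV. ?g (prod.swap z))"
    using Suc.IH[of _ "\<lambda>l. f (prod.swap z # l)" for z] pmf_swap by simp
  also have "\<dots> = (\<Sum>z\<in>UNIV. ?g z)"
    by (rule sum.reindex_bij_betw) (rule bij_swap)
  finally show ?case by simp
qed simp

lemma E_cong: "(\<And>l. length l = n \<Longrightarrow> f l = g l) \<Longrightarrow> E n \<nu> f = E n \<nu> g"
  unfolding E_def by (intro sum.cong refl arg_cong2[of _ _ _ _ "(*)"] E_from_cong) auto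

lemma E_add: "E n \<nu> (\<lambda>l. f l + g l) = E n \<nu> f + E n \<nu> g"
  by (simp add: E_def E_from_add distrib_left sum.distrib)

lemma E_cmult: "E n \<nu> (\<lambda>l. c * f l) = c * E n \<nu> f"
  by (simp add: E_def E_from_cmult sum_distrib_left mult.left_commute)

lemma E_cmult_right: "E n \<nu> (\<lambda>l. f l * c) = E n \<nu> f * c"
  using E_cmult[of n \<nu> c f] by (simp add: mult.commute)

lemma E_diff: "E n \<nu> (\<lambda>l. f l - g l) = E n \<nu> f - E n \<nu> g"
  using E_add[of n \<nu> f "\<lambda>l. -1 * g l"] E_cmult[of n \<nu> "-1" g] by simp

lemma E_sum: "E n \<nu> (\<lambda>l. \<Sum>i\<in>I. f i l) = (\<Sum>i\<in>I. E n \<nu> (f i))"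
proof (induction I rule: infinite_finite_induct)
  case (insert i I)
  then show ?case by (simp add: E_add)
qed (use E_cmult[of n \<nu> 0] in simp_all)

lemma E_const: "probability_vector \<nu> \<Longrightarrow> E n \<nu> (\<lambda>_. c) = c"
  by (simp add: E_def E_from_const probability_vector_def flip: sum_distrib_right)

lemma E_mono:
  "probability_vector \<nu> \<Longrightarrow> (\<And>l. length l = n \<Longrightarrow> f l \<le> g l) \<Longrightarrow> E n \<nu> f \<le> E n \<nu> g"
  unfolding E_def by (intro sum_mono mult_left_mono E_from_mono) (auto simp: probability_vector_def)

lemma E_take: "E (m + n) \<nu> (\<lambda>l. f (take m l)) = E m \<nu> f"
  by (simp add: E_def E_from_take)

lemma E_drop: "E (m + n) \<nu> (\<lambda>l. f (drop m l)) = E n (\<nu> v* matrix_power P m) f"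
proof -
  have "E (m + n) \<nu> (\<lambda>l. f (drop m l)) =
      (\<Sum>s\<in>UNIV. \<Sum>t\<in>UNIV. \<nu> $ s * (matrix_power P m $ s $ t * E_from n t f))"
    by (simp add: E_def E_from_drop sum_distrib_left)
  also have "\<dots> = (\<Sum>t\<in>UNIV. \<Sum>s\<in>UNIV. \<nu> $ s * (matrix_power P m $ s $ t * E_from n t f))"
    by (rule sum.swap)
  finally show ?thesis
    by (simp add: E_def vector_matrix_nth sum_distrib_right mult.assoc)
qed

lemma E_swap:
  assumes "\<And>s x y. pmf (e s) (x, y) = pmf (e s) (y, x)"
  shows "E n \<nu> (\<lambda>l. f (map prod.swap l)) = E n \<nu> f"
  unfolding E_def using E_from_swap[OF assms] by simp

lemma E_fst_eq_E_snd:
  assumes "\<And>s x y. pmf (e s) (x, y) = pmf (e s) (y, x)"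
  shows "E n \<nu> (\<lambda>l. f (map snd l)) = E n \<nu> (\<lambda>l. f (map fst l))"
  using E_swap[OF assms, of n \<nu> "\<lambda>l. f (map fst l)"] by (simp add: comp_def)

text \<open>Fubini for two independent copies of the emission process.\<close>
lemma E_exchange: "E n \<nu> (\<lambda>l. E m \<rho> (F l)) = E m \<rho> (\<lambda>l'. E n \<nu> (\<lambda>l. F l l'))"
proof -
  have "E_from n s (\<lambda>l. E m \<rho> (F l)) = E m \<rho> (\<lambda>l'. E_from n s (\<lambda>l. F l l'))" for s
    by (induction n arbitrary: s F) (simp_all add: E_sum E_cmult)
  then have "E n \<nu> (\<lambda>l. E m \<rho> (F l)) = (\<Sum>s\<in>UNIV. \<nu> $ s * E m \<rho> (\<lambda>l'. E_from n s (\<lambda>l. F l l')))"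
    by (simp add: E_def[of n])
  also have "\<dots> = E m \<rho> (\<lambda>l'. E n \<nu> (\<lambda>l. F l l'))"
    by (simp add: E_def[of n] E_sum E_cmult)
  finally show ?thesis .
qed

text \<open>Jensen's inequality, from the tangent to the exponential function at the mean.\<close>
lemma exp_E_le_E_exp:
  assumes "probability_vector \<nu>"
  shows "exp (E n \<nu> f) \<le> E n \<nu> (\<lambda>l. exp (f l))"
proof -
  have "exp (E n \<nu> f) * (1 + (f l - E n \<nu> f)) \<le> exp (f l)" for l
  proof -
    have "exp (E n \<nu> f) * (1 + (f l - E n \<nu> f)) \<le> exp (E n \<nu> f) * exp (f l - E n \<nu> f)"
      by (intro mult_left_mono exp_ge_add_one_self) auto
    then show ?thesis by (simp flip: exp_add)
  qed
  then have "E n \<nu> (\<lambda>l. exp (E n \<nu> f) * (1 + (f l - E n \<nu> f))) \<le> E n \<nu> (\<lambda>l. exp (f l))"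
    by (intro E_mono assms) auto
  then show ?thesis by (simp add: E_cmult E_add E_diff E_const assms)
qed

section \<open>The mixing coefficient of the two words\<close>

text \<open>\<open>joint\<close> averages over the true law of the two words, \<open>indep\<close> over the
product of their marginal laws: it takes the first word from one copy of the process and the second word from
an independent copy.\<close>
definition joint :: "nat \<Rightarrow> real ^ 's \<Rightarrow> ('a list \<Rightarrow> 'a list \<Rightarrow> real) \<Rightarrow> real" where
  "joint n \<nu> F = E n \<nu> (\<lambda>l. F (map fst l) (map snd l))"

definition indep :: "nat \<Rightarrow> real ^ 's \<Rightarrow> ('a list \<Rightarrow> 'a list \<Rightarrow> real) \<Rightarrow> real" where
  "indep n \<nu> F = E n \<nu> (\<lambda>l. E n \<nu> (\<lambda>l'. F (map fst l) (map snd l')))"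

definition words :: "nat \<Rightarrow> 'a list set" where "words n = {u. length u = n}"

definition mixing :: "nat \<Rightarrow> real ^ 's \<Rightarrow> real" where
  "mixing n \<nu> = 1 / 2 * (\<Sum>u\<in>words n. \<Sum>v\<in>words n.
     \<bar>joint n \<nu> (\<lambda>x y. of_bool (x = u \<and> y = v)) - indep n \<nu> (\<lambda>x y. of_bool (x = u \<and> y = v))\<bar>)"

lemma finite_words: "finite (words n)"
  using finite_lists_length_eq[of "UNIV :: 'a set" n] by (simp add: words_def)

lemma sum_words_of_bool:
  assumes "x \<in> words n" "y \<in> words n"
  shows "(\<Sum>u\<in>words n. \<Sum>v\<in>words n. F u v * of_bool (x = u \<and> y = v)) = (F x y :: real)"
proof -
  have "(\<Sum>u\<in>words n. \<Sum>v\<in>words n. F u v * of_bool (x = u \<and> y = v)) =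
      (\<Sum>u\<in>words n. if x = u then (\<Sum>v\<in>words n. if y = v then F u v else 0) else 0)"
    by (intro sum.cong refl) (auto intro!: sum.cong sum.neutral)
  then show ?thesis using assms by (simp add: finite_words)
qed

text \<open>The map \<open>\<phi>\<close> will be the identity, a prefix or a suffix of the words: the
comparison of the two laws of a window is then a comparison of the laws of whole words.\<close>
lemma joint_minus_indep_expand:
  assumes "\<And>x. length x = N \<Longrightarrow> length (\<phi> x) = n"
  shows "joint N \<nu> (\<lambda>x y. F (\<phi> x) (\<phi> y)) - indep N \<nu> (\<lambda>x y. F (\<phi> x) (\<phi> y)) =
    (\<Sum>u\<in>words n. \<Sum>v\<in>words n. F u v *
      (joint N \<nu> (\<lambda>x y. of_bool (\<phi> x = u \<and> \<phi> y = v)) -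
       indep N \<nu> (\<lambda>x y. of_bool (\<phi> x = u \<and> \<phi> y = v))))"
proof -
  let ?G = "\<lambda>x y. \<Sum>u\<in>words n. \<Sum>v\<in>words n. F u v * of_bool (\<phi> x = u \<and> \<phi> y = v)"
  have F: "F (\<phi> x) (\<phi> y) = ?G x y" if "length x = N" "length y = N" for x y
    using sum_words_of_bool[of "\<phi> x" n "\<phi> y" F] assms that by (simp add: words_def)
  have "joint N \<nu> (\<lambda>x y. F (\<phi> x) (\<phi> y)) = joint N \<nu> ?G"
    unfolding joint_def by (rule E_cong) (simp add: F)
  moreover have "indep N \<nu> (\<lambda>x y. F (\<phi> x) (\<phi> y)) = indep N \<nu> ?G"
    unfolding indep_def by (intro E_cong) (simp add: F)
  ultimately show ?thesis
    by (simp add: joint_def indep_def E_sum E_cmult right_diff_distrib sum_subtractf)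
qed

lemma joint_minus_indep_le_mixing:
  assumes \<nu>: "probability_vector \<nu>"
    and F: "\<And>u v. length u = n \<Longrightarrow> length v = n \<Longrightarrow> a \<le> F u v \<and> F u v \<le> a + R"
  shows "\<bar>joint n \<nu> F - indep n \<nu> F\<bar> \<le> R * mixing n \<nu>"
proof -
  define d where "d u v = joint n \<nu> (\<lambda>x y. of_bool (x = u \<and> y = v)) -
      indep n \<nu> (\<lambda>x y. of_bool (x = u \<and> y = v))" for u v
  have expand: "joint n \<nu> G - indep n \<nu> G =
      (\<Sum>p\<in>words n \<times> words n. d (fst p) (snd p) * G (fst p) (snd p))" for G
    using joint_minus_indep_expand[of n "\<lambda>x. x" n \<nu> G]
    by (simp add: sum.cartesian_product mult.commute d_def case_prod_unfold)
  have "(\<Sum>p\<in>words n \<times> words n. d (fst p) (snd p)) = 0"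
    using expand[of "\<lambda>_ _. 1"] by (simp add: joint_def indep_def E_const[OF \<nu>])
  then have "\<bar>\<Sum>p\<in>words n \<times> words n. d (fst p) (snd p) * F (fst p) (snd p)\<bar>
      \<le> R * ((\<Sum>p\<in>words n \<times> words n. \<bar>d (fst p) (snd p)\<bar>) / 2)"
    by (rule sum_mult_le_oscillation[where a = a]) (use F in \<open>auto simp: words_def\<close>)
  then show ?thesis
    by (simp add: expand[of F] mixing_def sum.cartesian_product case_prod_unfold d_def)
qed

text \<open>Applying the same function to both words cannot raise the mixing coefficient. By duality twice the
left hand side is the difference of the two expectations for the test function that is the sign of the
discrepancy, and this test function depends on the full words with values in \<open>[-1, 1]\<close>.\<close>
lemma mixing_image_le:
  assumes \<nu>: "probability_vector \<nu>" and \<phi>: "\<And>x. length x = N \<Longrightarrow> length (\<phi> x) = n"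
  shows "1 / 2 * (\<Sum>u\<in>words n. \<Sum>v\<in>words n.
     \<bar>joint N \<nu> (\<lambda>x y. of_bool (\<phi> x = u \<and> \<phi> y = v)) -
      indep N \<nu> (\<lambda>x y. of_bool (\<phi> x = u \<and> \<phi> y = v))\<bar>) \<le> mixing N \<nu>"
proof -
  define d where "d u v = joint N \<nu> (\<lambda>x y. of_bool (\<phi> x = u \<and> \<phi> y = v)) -
      indep N \<nu> (\<lambda>x y. of_bool (\<phi> x = u \<and> \<phi> y = v))" for u v
  have "(\<Sum>u\<in>words n. \<Sum>v\<in>words n. \<bar>d u v\<bar>) = (\<Sum>u\<in>words n. \<Sum>v\<in>words n. sgn (d u v) * d u v)"
    by (simp add: abs_sgn mult.commute)
  also have "\<dots> = joint N \<nu> (\<lambda>x y. sgn (d (\<phi> x) (\<phi> y))) - indep N \<nu> (\<lambda>x y. sgn (d (\<phi> x) (\<phi> y)))"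
    using joint_minus_indep_expand[OF \<phi>, where F = "\<lambda>u v. sgn (d u v)"] by (simp add: d_def)
  also have "\<dots> \<le> \<bar>\<dots>\<bar>" by (rule abs_ge_self)
  also have "\<dots> \<le> 2 * mixing N \<nu>"
    by (rule joint_minus_indep_le_mixing[OF \<nu>, where a = "-1"]) (auto simp: sgn_real_def)
  finally show ?thesis by (simp add: d_def)
qed

lemma mixing_le_1:
  assumes \<nu>: "probability_vector \<nu>"
  shows "mixing n \<nu> \<le> 1"
proof -
  define d where "d u v = joint n \<nu> (\<lambda>x y. of_bool (x = u \<and> y = v)) -
      indep n \<nu> (\<lambda>x y. of_bool (x = u \<and> y = v))" for u v
  have "(\<Sum>u\<in>words n. \<Sum>v\<in>words n. \<bar>d u v\<bar>) = (\<Sum>u\<in>words n. \<Sum>v\<in>words n. sgn (d u v) * d u v)"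
    by (simp add: abs_sgn mult.commute)
  also have "\<dots> = joint n \<nu> (\<lambda>x y. sgn (d x y)) - indep n \<nu> (\<lambda>x y. sgn (d x y))"
    using joint_minus_indep_expand[of n "\<lambda>x. x" n \<nu> "\<lambda>u v. sgn (d u v)"] by (simp add: d_def)
  also have "\<dots> \<le> 1 - (-1)"
  proof (rule diff_mono)
    have "joint n \<nu> (\<lambda>x y. sgn (d x y)) \<le> E n \<nu> (\<lambda>_. 1)"
      unfolding joint_def by (intro E_mono \<nu>) (auto simp: sgn_real_def)
    then show "joint n \<nu> (\<lambda>x y. sgn (d x y)) \<le> 1" by (simp add: E_const[OF \<nu>])
    have "E n \<nu> (\<lambda>_. E n \<nu> (\<lambda>_. -1)) \<le> indep n \<nu> (\<lambda>x y. sgn (d x y))"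
      unfolding indep_def by (intro E_mono \<nu>) (auto simp: sgn_real_def)
    then show "-1 \<le> indep n \<nu> (\<lambda>x y. sgn (d x y))" by (simp add: E_const[OF \<nu>])
  qed
  finally show ?thesis by (simp add: mixing_def d_def)
qed

lemma mixing_mono:
  assumes "probability_vector \<nu>"
  shows "mixing m \<nu> \<le> mixing (m + n) \<nu>"
proof -
  have joint: "joint (m + n) \<nu> (\<lambda>x y. F (take m x) (take m y)) = joint m \<nu> F" for F
    using E_take[of m n \<nu> "\<lambda>l. F (map fst l) (map snd l)"] by (simp add: joint_def take_map)
  have indep: "indep (m + n) \<nu> (\<lambda>x y. F (take m x) (take m y)) = indep m \<nu> F" for F
    using E_take[of m n \<nu> "\<lambda>l. E m \<nu> (\<lambda>l'. F (map fst l) (map snd l'))"]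
      E_take[of m n \<nu> "\<lambda>l'. F u (map snd l')" for u]
    by (simp add: indep_def take_map)
  let ?I = "\<lambda>u v x y. of_bool (x = u \<and> y = v) :: real"
  show ?thesis
    using mixing_image_le[OF assms, of "m + n" "take m" m]
    by (simp add: mixing_def[of m] joint[of "?I u v" for u v] indep[of "?I u v" for u v])
qed

text \<open>The law of the window after time \<open>m\<close> is that of a chain started from the distribution
at time \<open>m\<close>. This is how the mixing coefficient for one initial distribution controls it for
others.\<close>
lemma mixing_shift_le:
  assumes "probability_vector \<nu>"
  shows "mixing n (\<nu> v* matrix_power P m) \<le> mixing (m + n) \<nu>"
proof -
  let ?\<rho> = "\<nu> v* matrix_power P m"
  have joint: "joint (m + n) \<nu> (\<lambda>x y. F (drop m x) (drop m y)) = joint n ?\<rho> F" for F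
    using E_drop[of m n \<nu> "\<lambda>l. F (map fst l) (map snd l)"] by (simp add: joint_def drop_map)
  have indep: "indep (m + n) \<nu> (\<lambda>x y. F (drop m x) (drop m y)) = indep n ?\<rho> F" for F
    using E_drop[of m n \<nu> "\<lambda>l. E n ?\<rho> (\<lambda>l'. F (map fst l) (map snd l'))"]
      E_drop[of m n \<nu> "\<lambda>l'. F u (map snd l')" for u]
    by (simp add: indep_def drop_map)
  let ?I = "\<lambda>u v x y. of_bool (x = u \<and> y = v) :: real"
  show ?thesis
    using mixing_image_le[OF assms, of "m + n" "drop m" n]
    by (simp add: mixing_def[of n] joint[of "?I u v" for u v] indep[of "?I u v" for u v])
qed

end

section \<open>Concentration for functions with bounded differences\<close>

definition bounded_differences :: "real \<Rightarrow> ('b list \<Rightarrow> real) \<Rightarrow> bool" where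
  "bounded_differences c f \<longleftrightarrow> (\<forall>u x x' v. \<bar>f (u @ x # v) - f (u @ x' # v)\<bar> \<le> c)"

lemma bounded_differences_prepend:
  assumes "bounded_differences c f"
  shows "bounded_differences c (\<lambda>l. f (w @ l))"
  using assms unfolding bounded_differences_def by (metis append.assoc)

lemma bounded_differences_prefix:
  assumes f: "bounded_differences c f" and "length w = length w'"
  shows "\<bar>f (w @ l) - f (w' @ l)\<bar> \<le> c * real (length w)"
  using assms(2,1)
proof (induction w w' arbitrary: f rule: list_induct2)
  case (Cons x w x' w')
  have "\<bar>f (x # w @ l) - f (x' # w @ l)\<bar> \<le> c"
    using Cons.prems unfolding bounded_differences_def by (metis append_Nil)
  moreover have "\<bar>f (x' # w @ l) - f (x' # w' @ l)\<bar> \<le> c * real (length w)"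
    using Cons.IH[of "\<lambda>l. f ([x'] @ l)"] bounded_differences_prepend[OF Cons.prems, of "[x']"] by simp
  ultimately show ?case by (simp add: distrib_left)
qed simp

locale minorized_kernel = emission_kernel P e
  for P :: "real ^ 's::finite ^ 's" and e :: "'s \<Rightarrow> ('a::finite \<times> 'a) pmf" +
  fixes k :: nat and \<epsilon> :: real
  assumes k_pos: "k \<ge> 1" and \<epsilon>_pos: "0 < \<epsilon>" and \<epsilon>_less_1: "\<epsilon> < 1"
    and minorization: "\<And>s t. \<epsilon> \<le> matrix_power P k $ s $ t"
begin

lemma tv_dist_rows_le: "tv_dist (matrix_power P k $ s) (matrix_power P k $ t) \<le> 1 - \<epsilon>"
proof -
  have row: "axis s 1 v* A = A $ s" for s and A :: "real ^ 's ^ 's"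
  proof -
    have "(\<Sum>i\<in>UNIV. axis s 1 $ i * A $ i $ j) = (\<Sum>i\<in>UNIV. if s = i then A $ i $ j else 0)" for j
      by (rule sum.cong) (auto simp: axis_def)
    then show ?thesis by (simp add: vec_eq_iff vector_matrix_nth)
  qed
  have point: "probability_vector (axis s 1 :: real ^ 's)" for s
    by (simp add: probability_vector_def axis_def)
  have "tv_dist (axis s 1 v* matrix_power P k) (axis t 1 v* matrix_power P k)
      \<le> (1 - \<epsilon>) * tv_dist (axis s 1) (axis t 1)"
    using \<epsilon>_pos
    by (intro tv_dist_contraction point stochastic_matrix_power stochastic minorization) simp
  also have "\<dots> \<le> (1 - \<epsilon>) * 1"
    using \<epsilon>_less_1 by (intro mult_left_mono tv_dist_le_1 point) auto
  finally show ?thesis by (simp add: row)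
qed

text \<open>The influence of the initial state on a function with bounded differences is bounded uniformly in
the horizon. Replacing the first \<open>k\<close> letters by a fixed word costs \<open>c k\<close> for either
initial state; afterwards only the state at time \<open>k\<close> matters, and its laws are at distance at
most \<open>1 - \<epsilon>\<close>. The bound \<open>R\<close> therefore reproduces itself if
\<open>R = 2 c k + (1 - \<epsilon>) R\<close>, that is for \<open>R = 2 c k / \<epsilon>\<close>.\<close>
lemma E_from_oscillation:
  assumes "bounded_differences c f"
  shows "\<bar>E_from n s f - E_from n t f\<bar> \<le> 2 * c * real k / \<epsilon>"
  using assms
proof (induction n arbitrary: s t f rule: less_induct)
  case (less n)
  have c0: "0 \<le> c" using less.prems unfolding bounded_differences_def by (meson abs_ge_zero order.trans)
  have close: "\<bar>E_from n s f - E_from n s g\<bar> \<le> c * real k"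
    if "\<And>l. length l = n \<Longrightarrow> \<bar>f l - g l\<bar> \<le> c * real k" for s g
  proof -
    have "E_from n s f \<le> E_from n s (\<lambda>l. g l + c * real k)"
      "E_from n s g \<le> E_from n s (\<lambda>l. f l + c * real k)"
      using that by (intro E_from_mono; fastforce simp: abs_le_iff)+
    then show ?thesis by (simp add: E_from_add E_from_const)
  qed
  show ?case
  proof (cases "n < k")
    case True
    define w where "w = replicate n (undefined :: 'a \<times> 'a)"
    have "\<bar>f l - f w\<bar> \<le> c * real k" if "length l = n" for l
    proof -
      have "\<bar>f l - f w\<bar> \<le> c * real n"
        using bounded_differences_prefix[OF less.prems, of l w "[]"] that by (simp add: w_def)
      also have "\<dots> \<le> c * real k" using True c0 by (intro mult_left_mono) auto
      finally show ?thesis .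
    qed
    then have "\<bar>E_from n s f - f w\<bar> \<le> c * real k" for s
      using close[of "\<lambda>_. f w"] by (simp add: E_from_const)
    from this[of s] this[of t] have "\<bar>E_from n s f - E_from n t f\<bar> \<le> 2 * c * real k" by linarith
    also have "\<dots> \<le> 2 * c * real k / \<epsilon>"
      using \<epsilon>_pos \<epsilon>_less_1 c0 by (simp add: pos_le_divide_eq mult_left_le)
    finally show ?thesis .
  next
    case False
    define w where "w = replicate k (undefined :: 'a \<times> 'a)"
    define g where "g l = f (w @ l)" for l
    define R where "R = 2 * c * real k / \<epsilon>"
    have R0: "0 \<le> R" using c0 \<epsilon>_pos by (simp add: R_def)
    have n: "k + (n - k) = n" using False by simp
    have "\<bar>f l - g (drop k l)\<bar> \<le> c * real k" if "length l = n" for l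
      using bounded_differences_prefix[OF less.prems, of "take k l" w "drop k l"] that False
      by (simp add: w_def g_def)
    note close1 = close[OF this]
    have "\<bar>E_from (n - k) u g - E_from (n - k) v g\<bar> \<le> R" for u v
      unfolding R_def g_def using False k_pos
      by (intro less.IH bounded_differences_prepend less.prems) auto
    note interval = oscillation_interval[of "\<lambda>u. E_from (n - k) u g" R, OF this]
    have split: "E_from n s (\<lambda>l. g (drop k l)) = (\<Sum>u\<in>UNIV. matrix_power P k $ s $ u * E_from (n - k) u g)" for s
      using E_from_drop[of k "n - k" s g] n by simp
    have "\<bar>E_from n s (\<lambda>l. g (drop k l)) - E_from n t (\<lambda>l. g (drop k l))\<bar>
        \<le> R * tv_dist (matrix_power P k $ s) (matrix_power P k $ t)"
      unfolding split using stochastic_matrix_power[OF stochastic, of k]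
      by (intro expectation_diff_le_tv_dist[OF _ _ interval]) (auto simp: stochastic_matrix_def)
    also have "\<dots> \<le> R * (1 - \<epsilon>)" by (intro mult_left_mono tv_dist_rows_le R0)
    finally have "\<bar>E_from n s f - E_from n t f\<bar> \<le> 2 * (c * real k) + R * (1 - \<epsilon>)"
      using close1[of s] close1[of t] by linarith
    also have "\<dots> = R" using \<epsilon>_pos by (simp add: R_def field_simps)
    finally show ?thesis by (simp add: R_def)
  qed
qed

text \<open>The martingale method of McDiarmid's inequality, with Hoeffding's lemma at each step. Given the
past, the conditional mean of \<open>f\<close> varies with the next pair by at most \<open>c\<close>, and with
the next state by at most the oscillation bound above.\<close>
lemma E_from_exp_moment:
  assumes "bounded_differences c f" and l: "0 < l"
  shows "E_from n s (\<lambda>x. exp (l * f x))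
    \<le> exp (l * E_from n s f + real n * (l\<^sup>2 * (c + 2 * c * real k / \<epsilon>)\<^sup>2 / 8))"
  using assms(1)
proof (induction n arbitrary: s f)
  case (Suc n)
  define R where "R = c + 2 * c * real k / \<epsilon>"
  define A where "A = l\<^sup>2 * R\<^sup>2 / 8"
  define p where "p zt = pmf (e s) (fst zt) * P $ s $ (snd zt)" for zt
  define h where "h zt = E_from n (snd zt) (\<lambda>x. f (fst zt # x))" for zt
  have step: "E_from (Suc n) s (\<lambda>x. \<phi> (f x)) =
      (\<Sum>zt\<in>UNIV. p zt * E_from n (snd zt) (\<lambda>x. \<phi> (f (fst zt # x))))" for \<phi> :: "real \<Rightarrow> real"
  proof -
    have "E_from (Suc n) s (\<lambda>x. \<phi> (f x)) = (\<Sum>(z, t)\<in>UNIV \<times> UNIV.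
        pmf (e s) z * (P $ s $ t * E_from n t (\<lambda>x. \<phi> (f (z # x)))))"
      by (simp only: E_from.simps sum_distrib_left sum.cartesian_product)
    then show ?thesis by (simp add: p_def case_prod_unfold mult.assoc)
  qed
  have osc: "\<bar>h i - h j\<bar> \<le> R" for i j
  proof -
    have "\<bar>E_from n (snd i) (\<lambda>x. f ([fst i] @ x)) - E_from n (snd j) (\<lambda>x. f ([fst i] @ x))\<bar>
        \<le> 2 * c * real k / \<epsilon>"
      by (intro E_from_oscillation bounded_differences_prepend Suc.prems)
    moreover have "\<bar>E_from n (snd j) (\<lambda>x. f (fst i # x)) - E_from n (snd j) (\<lambda>x. f (fst j # x))\<bar> \<le> c"
    proof -
      have le: "f (z # x) \<le> f (z' # x) + c" for z z' x
        using Suc.prems unfolding bounded_differences_def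
        by (metis append_Nil abs_le_iff diff_le_eq add.commute)
      have "E_from n (snd j) (\<lambda>x. f (z # x)) \<le> E_from n (snd j) (\<lambda>x. f (z' # x) + c)" for z z'
        by (intro E_from_mono le)
      then show ?thesis by (simp add: E_from_add E_from_const abs_le_iff diff_le_eq add.commute)
    qed
    ultimately show ?thesis unfolding h_def R_def by simp
  qed
  have p: "0 \<le> p zt" "sum p UNIV = 1" for zt
    using step[of "\<lambda>_. 1"] by (simp_all add: p_def transition_nonneg E_from_const[of _ _ 1] del: E_from.simps)
  have "E_from (Suc n) s (\<lambda>x. exp (l * f x)) =
      (\<Sum>zt\<in>UNIV. p zt * E_from n (snd zt) (\<lambda>x. exp (l * f (fst zt # x))))"
    by (rule step[of "\<lambda>y. exp (l * y)"])
  also have "\<dots> \<le> (\<Sum>zt\<in>UNIV. p zt * exp (l * h zt + real n * A))"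
    unfolding h_def A_def R_def
    using Suc.IH[of "\<lambda>x. f ([z] @ x)" for z, OF bounded_differences_prepend[OF Suc.prems]]
    by (intro sum_mono mult_left_mono p(1)) simp
  also have "\<dots> = (\<Sum>zt\<in>UNIV. p zt * exp (l * h zt)) * exp (real n * A)"
    by (simp add: exp_add sum_distrib_right mult.assoc)
  also have "\<dots> \<le> exp (l * (\<Sum>zt\<in>UNIV. p zt * h zt) + A) * exp (real n * A)"
    unfolding A_def by (intro mult_right_mono exp_moment_le_oscillation p osc l) auto
  also have "(\<Sum>zt\<in>UNIV. p zt * h zt) = E_from (Suc n) s f"
    unfolding h_def by (rule step[of "\<lambda>y. y", symmetric])
  also have "exp (l * E_from (Suc n) s f + A) * exp (real n * A) =
      exp (l * E_from (Suc n) s f + real (Suc n) * A)"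
    by (simp only: exp_add[symmetric]) (simp add: algebra_simps del: E_from.simps)
  finally show ?case by (simp only: A_def R_def)
qed simp

text \<open>The random initial state counts as one more step, hence \<open>n + 1\<close>.\<close>
lemma E_exp_moment:
  assumes f: "bounded_differences c f" and l: "0 < l" and \<nu>: "probability_vector \<nu>"
  shows "E n \<nu> (\<lambda>x. exp (l * f x))
    \<le> exp (l * E n \<nu> f + (real n + 1) * (l\<^sup>2 * (c + 2 * c * real k / \<epsilon>)\<^sup>2 / 8))"
proof -
  define R where "R = c + 2 * c * real k / \<epsilon>"
  define A where "A = l\<^sup>2 * R\<^sup>2 / 8"
  have c0: "0 \<le> c" using f unfolding bounded_differences_def by (meson abs_ge_zero order.trans)
  have "\<bar>E_from n s f - E_from n t f\<bar> \<le> R" for s t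
    using E_from_oscillation[OF f, of n s t] c0 by (simp add: R_def)
  moreover have "0 \<le> \<nu> $ s" "(\<Sum>s\<in>UNIV. \<nu> $ s) = 1" for s
    using \<nu> by (auto simp: probability_vector_def)
  ultimately have "(\<Sum>s\<in>UNIV. \<nu> $ s * exp (l * E_from n s f)) \<le> exp (l * E n \<nu> f + A)"
    unfolding A_def E_def using l by (intro exp_moment_le_oscillation)
  moreover have "E n \<nu> (\<lambda>x. exp (l * f x)) \<le> (\<Sum>s\<in>UNIV. \<nu> $ s * exp (l * E_from n s f)) * exp (real n * A)"
    unfolding E_def sum_distrib_right mult.assoc exp_add[symmetric]
    using E_from_exp_moment[OF f l, of n] \<nu>
    by (intro sum_mono mult_left_mono) (auto simp: A_def R_def probability_vector_def)
  ultimately have "E n \<nu> (\<lambda>x. exp (l * f x)) \<le> exp (l * E n \<nu> f + A) * exp (real n * A)"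
    by (meson exp_ge_zero mult_right_mono order.trans)
  also have "\<dots> = exp (l * E n \<nu> f + (real n + 1) * A)"
    by (simp only: exp_add[symmetric]) (simp add: algebra_simps)
  finally show ?thesis by (simp only: A_def R_def)
qed

lemma E_diff_le_tv_dist:
  assumes "probability_vector \<nu>" "probability_vector \<rho>"
    and f: "\<And>l. length l = n \<Longrightarrow> 0 \<le> f l \<and> f l \<le> R"
  shows "\<bar>E n \<nu> f - E n \<rho> f\<bar> \<le> R * tv_dist \<nu> \<rho>"
  unfolding E_def
proof (rule expectation_diff_le_tv_dist[OF assms(1,2), where a = 0])
  fix s
  have "E_from n s (\<lambda>_. 0) \<le> E_from n s f" "E_from n s f \<le> E_from n s (\<lambda>_. R)"
    using f by (auto intro!: E_from_mono)
  then show "0 \<le> E_from n s f \<and> E_from n s f \<le> 0 + R" by (simp add: E_from_const)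
qed

end

section \<open>The stationary chain\<close>

locale stationary_kernel = minorized_kernel P e k \<epsilon>
  for P :: "real ^ 's::finite ^ 's" and e :: "'s \<Rightarrow> ('a::finite \<times> 'a) pmf" and k :: nat and \<epsilon> :: real +
  fixes \<pi> :: "real ^ 's"
  assumes stationary: "stationary_distribution P \<pi>"
    and emission_symmetric: "\<And>s x y. pmf (e s) (x, y) = pmf (e s) (y, x)"
begin

lemma \<pi>_prob: "probability_vector \<pi>" and \<pi>_fixed: "\<pi> v* P = \<pi>"
  using stationary by (auto simp: stationary_distribution_def)

text \<open>For symmetric emissions both words have this law, so independent words become
exchangeable.\<close>
definition marginal :: "nat \<Rightarrow> ('a list \<Rightarrow> real) \<Rightarrow> real" where
  "marginal n f = E n \<pi> (\<lambda>l. f (map fst l))"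

lemma marginal_mono: "(\<And>x. length x = n \<Longrightarrow> f x \<le> g x) \<Longrightarrow> marginal n f \<le> marginal n g"
  unfolding marginal_def by (rule E_mono[OF \<pi>_prob]) simp

lemma marginal_add: "marginal n (\<lambda>x. f x + g x) = marginal n f + marginal n g"
  unfolding marginal_def by (rule E_add)

lemma marginal_const: "marginal n (\<lambda>_. c) = c"
  unfolding marginal_def by (rule E_const[OF \<pi>_prob])

lemma marginal_take: "marginal (m + n) (\<lambda>x. f (take m x)) = marginal m f"
  using E_take[of m n \<pi> "\<lambda>l. f (map fst l)"] by (simp add: marginal_def take_map)

lemma marginal_drop: "marginal (m + n) (\<lambda>x. f (drop m x)) = marginal n f"
  using E_drop[of m n \<pi> "\<lambda>l. f (map fst l)"]
  by (simp add: marginal_def drop_map stationary_matrix_power[OF \<pi>_fixed])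

lemma marginal_exchange: "marginal m (\<lambda>x. marginal n (F x)) = marginal n (\<lambda>y. marginal m (\<lambda>x. F x y))"
  unfolding marginal_def by (rule E_exchange)

lemma indep_eq_marginal: "indep n \<pi> F = marginal n (\<lambda>x. marginal n (F x))"
  unfolding indep_def marginal_def
  by (simp add: E_fst_eq_E_snd[OF emission_symmetric, of n \<pi> "F u" for u])

definition indep_LC :: "nat \<Rightarrow> nat \<Rightarrow> real" where
  "indep_LC p q = marginal p (\<lambda>x. marginal q (\<lambda>y. real (lcs x y)))"

lemma indep_LC_commute: "indep_LC p q = indep_LC q p"
  unfolding indep_LC_def by (subst marginal_exchange) (simp add: lcs_commute)

text \<open>Two words of length \<open>p + q\<close> split into pieces with lengths \<open>(p, q)\<close>,
followed by pieces with lengths \<open>(q, p)\<close>. For independent stationary words the two expectations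
agree by symmetry, so an unbalanced comparison is on average worth no more than half of a balanced one with
the same number of letters. For dependent words the second pair of pieces would come from shifted windows, and
this argument breaks down.\<close>
lemma indep_LC_le_half: "indep_LC p q \<le> indep_LC (p + q) (p + q) / 2"
proof -
  have "indep_LC p q = marginal (p + q) (\<lambda>x. marginal (p + q) (\<lambda>y. real (lcs (take p x) (take q y))))"
    using marginal_take[of p q "\<lambda>x. marginal q (\<lambda>y. real (lcs x y))"]
      marginal_take[of q p "\<lambda>y. real (lcs u y)" for u]
    by (simp add: indep_LC_def add.commute)
  moreover have "indep_LC q p = marginal (p + q) (\<lambda>x. marginal (p + q) (\<lambda>y. real (lcs (drop p x) (drop q y))))"
    using marginal_drop[of p q "\<lambda>x. marginal p (\<lambda>y. real (lcs x y))"]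
      marginal_drop[of q p "\<lambda>y. real (lcs u y)" for u]
    by (simp add: indep_LC_def add.commute)
  ultimately have "indep_LC p q + indep_LC q p = marginal (p + q) (\<lambda>x. marginal (p + q)
      (\<lambda>y. real (lcs (take p x) (take q y)) + real (lcs (drop p x) (drop q y))))"
    by (simp add: marginal_add)
  also have "\<dots> \<le> indep_LC (p + q) (p + q)"
    unfolding indep_LC_def
    by (intro marginal_mono) (metis lcs_take_drop_superadditive of_nat_add of_nat_mono)
  finally show ?thesis using indep_LC_commute[of p q] by simp
qed

lemma indep_cut_score_le:
  assumes "set ps \<subseteq> {..m}"
  shows "marginal (sum_list ps) (\<lambda>x. marginal (m * length ps - sum_list ps)
      (\<lambda>y. real (cut_score m ps x y))) \<le> real (length ps) * (indep_LC m m / 2)"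
  using assms
proof (induction ps)
  case Nil
  then show ?case by (simp add: marginal_const)
next
  case (Cons p ps)
  define r where "r = sum_list ps"
  define t where "t = m * length ps - sum_list ps"
  have p: "p + (m - p) = m" using Cons.prems by simp
  have "sum_list ps \<le> m * length ps"
    using Cons.prems by (induction ps) auto
  then have t: "m * length (p # ps) - sum_list (p # ps) = (m - p) + t"
    using p by (simp add: t_def)
  have "marginal (p + r) (\<lambda>x. marginal ((m - p) + t) (\<lambda>y. real (cut_score m (p # ps) x y)))
      = marginal (p + r) (\<lambda>x. marginal ((m - p) + t) (\<lambda>y. real (lcs (take p x) (take (m - p) y)))) +
        marginal (p + r) (\<lambda>x. marginal ((m - p) + t) (\<lambda>y. real (cut_score m ps (drop p x) (drop (m - p) y))))"
    by (simp add: marginal_add)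
  also have "marginal (p + r) (\<lambda>x. marginal ((m - p) + t) (\<lambda>y. real (lcs (take p x) (take (m - p) y))))
      = indep_LC p (m - p)"
    using marginal_take[of p r "\<lambda>x. marginal (m - p) (\<lambda>y. real (lcs x y))"]
      marginal_take[of "m - p" t "\<lambda>y. real (lcs u y)" for u]
    by (simp add: indep_LC_def)
  also have "marginal (p + r) (\<lambda>x. marginal ((m - p) + t) (\<lambda>y. real (cut_score m ps (drop p x) (drop (m - p) y))))
      = marginal r (\<lambda>x. marginal t (\<lambda>y. real (cut_score m ps x y)))"
    using marginal_drop[of p r "\<lambda>x. marginal t (\<lambda>y. real (cut_score m ps x y))"]
      marginal_drop[of "m - p" t "\<lambda>y. real (cut_score m ps u y)" for u]
    by simp
  also have "indep_LC p (m - p) + marginal r (\<lambda>x. marginal t (\<lambda>y. real (cut_score m ps x y)))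
      \<le> indep_LC m m / 2 + real (length ps) * (indep_LC m m / 2)"
    using indep_LC_le_half[of p "m - p"] Cons p by (intro add_mono) (auto simp: r_def t_def)
  finally show ?case unfolding t by (simp add: r_def distrib_right)
qed

definition stationary_LC :: "nat \<Rightarrow> real" where
  "stationary_LC n = joint n \<pi> (\<lambda>x y. real (lcs x y))"

lemma stationary_LC_bounds: "0 \<le> stationary_LC n" "stationary_LC n \<le> real n"
proof -
  have "E n \<pi> (\<lambda>_. 0) \<le> stationary_LC n" "stationary_LC n \<le> E n \<pi> (\<lambda>_. real n)"
    unfolding stationary_LC_def joint_def
    by (intro E_mono[OF \<pi>_prob]; use lcs_map_le_length in fastforce)+
  then show "0 \<le> stationary_LC n" "stationary_LC n \<le> real n" by (simp_all add: E_const[OF \<pi>_prob])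
qed

lemma joint_LC_drop:
  "joint (m + n) \<nu> (\<lambda>x y. real (lcs (drop m x) (drop m y)))
    = joint n (\<nu> v* matrix_power P m) (\<lambda>x y. real (lcs x y))"
  using E_drop[of m n \<nu> "\<lambda>l. real (lcs (map fst l) (map snd l))"] by (simp add: joint_def drop_map)

lemma stationary_LC_superadditive: "stationary_LC m + stationary_LC n \<le> stationary_LC (m + n)"
proof -
  have "stationary_LC m + stationary_LC n = E (m + n) \<pi> (\<lambda>l. real (lcs (take m (map fst l)) (take m (map snd l)))
      + real (lcs (drop m (map fst l)) (drop m (map snd l))))"
    using E_take[of m n \<pi> "\<lambda>l. real (lcs (map fst l) (map snd l))"] joint_LC_drop[of m n \<pi>]
    by (simp add: stationary_LC_def joint_def take_map stationary_matrix_power[OF \<pi>_fixed] E_add)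
  also have "\<dots> \<le> stationary_LC (m + n)"
    unfolding stationary_LC_def joint_def
    by (intro E_mono[OF \<pi>_prob]) (metis lcs_take_drop_superadditive of_nat_add of_nat_mono)
  finally show ?thesis .
qed

lemma joint_minus_indep_nat_le:
  assumes "\<And>u v. length u = n \<Longrightarrow> length v = n \<Longrightarrow> F u v \<le> n"
  shows "\<bar>joint n \<pi> (\<lambda>x y. real (F x y)) - indep n \<pi> (\<lambda>x y. real (F x y))\<bar> \<le> real n * mixing n \<pi>"
  by (rule joint_minus_indep_le_mixing[OF \<pi>_prob, where a = 0]) (use assms in auto)

text \<open>Changing one pair changes one letter in each of the two words.\<close>
lemma bounded_differences_cut_score:
  "bounded_differences 2 (\<lambda>l :: ('a \<times> 'a) list. real (cut_score m ps (map fst l) (map snd l)))"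
  unfolding bounded_differences_def
proof (intro allI)
  fix u v :: "('a \<times> 'a) list" and z z' :: "'a \<times> 'a"
  have "cut_score m ps (map fst u @ fst z # map fst v) (map snd u @ snd z # map snd v)
      \<le> cut_score m ps (map fst u @ fst z' # map fst v) (map snd u @ snd z' # map snd v) + 2" for z z' :: "'a \<times> 'a"
    using cut_score_change_left[of m ps "map fst u" "fst z" "map fst v" "map snd u @ snd z # map snd v" "fst z'"]
      cut_score_change_right[of m ps "map fst u @ fst z' # map fst v" "map snd u" "snd z" "map snd v" "snd z'"]
    by linarith
  from this[of z z'] this[of z' z]
  show "\<bar>real (cut_score m ps (map fst (u @ z # v)) (map snd (u @ z # v))) -
      real (cut_score m ps (map fst (u @ z' # v)) (map snd (u @ z' # v)))\<bar> \<le> 2"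
    by simp
qed

text \<open>The constant \<open>c + 2 c k / \<epsilon>\<close> of the exponential moment bound for differences
\<open>c = 2\<close>.\<close>
definition spread :: real where "spread = 2 + 4 * real k / \<epsilon>"

text \<open>Up to \<open>2 K\<close> lost matches, the longest common subsequence of two words of length
\<open>m K\<close> is the best of at most \<open>(m + 1) ^ (2 K)\<close> cut scores with \<open>2 K\<close>
pairs of pieces. Each cut score has mean at most \<open>K * stationary_LC m + 2 m K B\<close>: passing to
independent words for the whole score costs \<open>m K B\<close>, and so does passing back in the balanced
comparisons that bound it. The exponential moment of the maximum is at most the sum of the exponential
moments.\<close>
lemma stationary_LC_multiple_le:
  assumes K: "K \<ge> 1" and m: "m \<ge> 1" and l: "0 < l" and B: "\<And>n. mixing n \<pi> \<le> B"
  shows "stationary_LC (m * K) \<le> 2 * real K + 2 * real K * ln (real m + 1) / l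
    + real K * stationary_LC m + 2 * real (m * K) * B + l * real (m * K) * (spread\<^sup>2 / 4)"
proof -
  define N where "N = m * K"
  define C where "C = cuts m (2 * K) N"
  define H where "H = real K * stationary_LC m + 2 * real N * B + real N * l * (spread\<^sup>2 / 4)"
  define S where "S ps x = real (cut_score m ps (map fst x) (map snd x))" for ps and x :: "('a \<times> 'a) list"
  have mean: "E N \<pi> (S ps) \<le> real K * stationary_LC m + 2 * real N * B" if "ps \<in> C" for ps
  proof -
    have ps: "length ps = 2 * K" "set ps \<subseteq> {..m}" "sum_list ps = N"
      using that by (auto simp: C_def cuts_def)
    have half: "m * length ps - sum_list ps = N" using ps by (simp add: N_def)
    have "E N \<pi> (S ps) = joint N \<pi> (\<lambda>x y. real (cut_score m ps x y))"
      by (simp add: S_def[abs_def] joint_def)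
    then have "E N \<pi> (S ps) \<le> indep N \<pi> (\<lambda>x y. real (cut_score m ps x y)) + real N * mixing N \<pi>"
      using joint_minus_indep_nat_le[of N "cut_score m ps"] cut_score_le_length[of m ps] by (smt (verit))
    moreover have "indep N \<pi> (\<lambda>x y. real (cut_score m ps x y)) \<le> real K * indep_LC m m"
      using indep_cut_score_le[OF ps(2)] unfolding half unfolding ps indep_eq_marginal by simp
    moreover have "indep_LC m m \<le> stationary_LC m + real m * mixing m \<pi>"
      using joint_minus_indep_nat_le[of m lcs] lcs_le_length
      unfolding stationary_LC_def indep_LC_def indep_eq_marginal by (smt (verit))
    then have "real K * indep_LC m m \<le> real K * (stationary_LC m + real m * mixing m \<pi>)"
      by (intro mult_left_mono) auto
    moreover have "real K * (stationary_LC m + real m * mixing m \<pi>) + real N * mixing N \<pi>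
        \<le> real K * (stationary_LC m + real m * B) + real N * B"
      by (intro add_mono mult_left_mono B) auto
    moreover have "real K * (stationary_LC m + real m * B) + real N * B
        = real K * stationary_LC m + 2 * real N * B" by (simp add: N_def algebra_simps)
    ultimately show ?thesis by linarith
  qed
  have spread: "2 + 2 * 2 * real k / \<epsilon> = spread" by (simp add: spread_def)
  have moment: "E N \<pi> (\<lambda>x. exp (l * S ps x)) \<le> exp (l * H)" if "ps \<in> C" for ps
  proof -
    have "E N \<pi> (\<lambda>x. exp (l * S ps x)) \<le> exp (l * E N \<pi> (S ps) + (real N + 1) * (l\<^sup>2 * spread\<^sup>2 / 8))"
      using E_exp_moment[OF bounded_differences_cut_score[of m ps] l \<pi>_prob, of N]
      unfolding spread by (simp only: S_def[abs_def])
    also have "\<dots> \<le> exp (l * H)"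
    proof -
      have "N \<ge> 1" using K m by (simp add: N_def Suc_le_eq)
      then have "(real N + 1) * (l\<^sup>2 * spread\<^sup>2 / 8) \<le> (2 * real N) * (l\<^sup>2 * spread\<^sup>2 / 8)"
        by (intro mult_right_mono) auto
      moreover have "l * E N \<pi> (S ps) \<le> l * (real K * stationary_LC m + 2 * real N * B)"
        using mean[OF that] l by (intro mult_left_mono) auto
      moreover have "l * H = l * (real K * stationary_LC m + 2 * real N * B) + (2 * real N) * (l\<^sup>2 * spread\<^sup>2 / 8)"
        by (simp add: H_def distrib_left power2_eq_square mult_ac)
      ultimately show ?thesis unfolding exp_le_cancel_iff by linarith
    qed
    finally show ?thesis .
  qed
  have "exp (l * stationary_LC N) = exp (E N \<pi> (\<lambda>x. l * real (lcs (map fst x) (map snd x))))"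
    by (simp add: E_cmult stationary_LC_def joint_def)
  also have "\<dots> \<le> E N \<pi> (\<lambda>x. exp (l * real (lcs (map fst x) (map snd x))))"
    by (rule exp_E_le_E_exp[OF \<pi>_prob])
  also have "\<dots> \<le> E N \<pi> (\<lambda>x. exp (l * (2 * real K)) * (\<Sum>ps\<in>C. exp (l * S ps x)))"
  proof (rule E_mono[OF \<pi>_prob])
    fix x :: "('a \<times> 'a) list" assume x: "length x = N"
    obtain ps where ps: "ps \<in> C" "lcs (map fst x) (map snd x) \<le> cut_score m ps (map fst x) (map snd x) + 2 * K"
      using lcs_le_cut_score[of "map fst x" "map snd x" m "2 * K"] x by (auto simp: N_def C_def)
    have "real (lcs (map fst x) (map snd x)) \<le> 2 * real K + S ps x"
      using ps(2) by (simp add: S_def)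
    then have "l * real (lcs (map fst x) (map snd x)) \<le> l * (2 * real K) + l * S ps x"
      using l by (simp flip: distrib_left)
    then have "exp (l * real (lcs (map fst x) (map snd x))) \<le> exp (l * (2 * real K)) * exp (l * S ps x)"
      by (simp flip: exp_add)
    also have "\<dots> \<le> exp (l * (2 * real K)) * (\<Sum>ps\<in>C. exp (l * S ps x))"
      using ps(1) finite_cuts unfolding C_def by (intro mult_left_mono member_le_sum) auto
    finally show "exp (l * real (lcs (map fst x) (map snd x))) \<le> \<dots>" .
  qed
  also have "\<dots> = exp (l * (2 * real K)) * (\<Sum>ps\<in>C. E N \<pi> (\<lambda>x. exp (l * S ps x)))"
    by (simp add: E_cmult E_sum)
  also have "\<dots> \<le> exp (l * (2 * real K)) * (real (card C) * exp (l * H))"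
    by (intro mult_left_mono sum_bounded_above moment) auto
  also have "\<dots> \<le> exp (l * (2 * real K)) * ((real m + 1) ^ (2 * K) * exp (l * H))"
  proof -
    have "real (card C) \<le> real ((m + 1) ^ (2 * K))"
      unfolding C_def by (simp only: of_nat_le_iff card_cuts_le)
    then show ?thesis by (intro mult_left_mono mult_right_mono) (auto simp: add.commute)
  qed
  also have "(real m + 1) ^ (2 * K) = exp (2 * real K * ln (real m + 1))"
    using exp_of_nat_mult[of "2 * K" "ln (real m + 1)"] by simp
  finally have "l * stationary_LC N \<le> l * (2 * real K) + (2 * real K * ln (real m + 1) + l * H)"
    by (simp flip: exp_add)
  then have "stationary_LC N \<le> (l * (2 * real K) + (2 * real K * ln (real m + 1) + l * H)) / l"
    using l by (simp add: pos_le_divide_eq mult.commute)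
  also have "\<dots> = 2 * real K + 2 * real K * ln (real m + 1) / l + H"
    using l by (simp add: add_divide_distrib)
  finally show ?thesis by (simp add: H_def N_def algebra_simps)
qed

text \<open>The limit of \<open>stationary_LC_multiple_le\<close> as \<open>K\<close> grows, with the
parameter of the exponential moment chosen to balance entropy against fluctuation.\<close>
lemma stationary_rate:
  assumes lim: "(\<lambda>n. stationary_LC n / real n) \<longlonglongrightarrow> \<gamma>" and B: "\<And>n. mixing n \<pi> \<le> B" and m: "m \<ge> 2"
  shows "\<gamma> \<le> stationary_LC m / real m + 2 * B + 2 / real m
    + (4 + spread\<^sup>2 / 4) * sqrt (ln (real m) / real m)"
proof -
  \<comment> \<open>The entropy contributes \<open>ln m / (l m)\<close> per letter and the fluctuation a multiple of \<open>l\<close>.\<close>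
  define l where "l = sqrt (ln (real m) / real m)"
  have ln_pos: "0 < ln (real m)" using m by simp
  then have l: "0 < l" using m by (simp add: l_def)
  have l2: "l * l = ln (real m) / real m" using ln_pos m by (simp add: l_def)
  have "ln (real m + 1) \<le> ln ((real m)\<^sup>2)"
  proof -
    have "real m + 1 \<le> real m * 2" using m by simp
    also have "\<dots> \<le> (real m)\<^sup>2" using m unfolding power2_eq_square by (intro mult_left_mono) auto
    finally show ?thesis using m by simp
  qed
  also have "\<dots> = 2 * (l * l * real m)" using m l2 by (simp add: ln_realpow)
  finally have entropy: "2 * ln (real m + 1) / (l * real m) \<le> 4 * l"
    using l m by (simp add: divide_le_eq mult.assoc mult.left_commute)
  have "stationary_LC (m * K) / real (m * K) \<le> stationary_LC m / real m + 2 * B + 2 / real m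
    + (4 + spread\<^sup>2 / 4) * l" if K: "K \<ge> 1" for K
  proof -
    have "stationary_LC (m * K) / real (m * K) \<le> (2 * real K + 2 * real K * ln (real m + 1) / l
      + real K * stationary_LC m + 2 * real (m * K) * B + l * real (m * K) * (spread\<^sup>2 / 4)) / real (m * K)"
      using stationary_LC_multiple_le[OF K _ l B, of m] m by (intro divide_right_mono) auto
    also have "\<dots> = 2 / real m + 2 * ln (real m + 1) / (l * real m) + stationary_LC m / real m
        + 2 * B + l * (spread\<^sup>2 / 4)"
      using K m l by (simp add: field_simps)
    finally show ?thesis using entropy by (simp add: algebra_simps)
  qed
  moreover have "(\<lambda>K. stationary_LC (m * K) / real (m * K)) \<longlonglongrightarrow> \<gamma>"
    using LIMSEQ_subseq_LIMSEQ[OF lim, of "\<lambda>K. m * K"] m by (simp add: strict_mono_def o_def)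
  ultimately show ?thesis unfolding l_def
    by (intro LIMSEQ_le_const2) auto
qed

section \<open>Other initial distributions\<close>

text \<open>Forgetting the first \<open>m\<close> letters costs at most \<open>m\<close> for either initial
distribution, and what remains starts from the distribution at time \<open>m\<close>, which is close to
\<open>\<pi>\<close>.\<close>
lemma LC_minus_stationary_LC:
  assumes \<nu>: "probability_vector \<nu>" and m: "m \<le> n"
  shows "\<bar>joint n \<nu> (\<lambda>x y. real (lcs x y)) - stationary_LC n\<bar>
    \<le> real m + real n * tv_dist (\<nu> v* matrix_power P m) \<pi>"
proof -
  define r where "r = n - m"
  have n: "n = m + r" using m by (simp add: r_def)
  have drop: "joint r (\<rho> v* matrix_power P m) (\<lambda>x y. real (lcs x y)) \<le> joint n \<rho> (\<lambda>x y. real (lcs x y)) \<and>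
      joint n \<rho> (\<lambda>x y. real (lcs x y)) \<le> real m + joint r (\<rho> v* matrix_power P m) (\<lambda>x y. real (lcs x y))"
    if \<rho>: "probability_vector \<rho>" for \<rho>
  proof
    have "joint n \<rho> (\<lambda>x y. real (lcs (drop m x) (drop m y))) \<le> joint n \<rho> (\<lambda>x y. real (lcs x y))"
      unfolding joint_def
      by (intro E_mono[OF \<rho>]) (simp add: lcs_mono suffix_imp_subseq suffix_drop)
    then show "joint r (\<rho> v* matrix_power P m) (\<lambda>x y. real (lcs x y)) \<le> joint n \<rho> (\<lambda>x y. real (lcs x y))"
      using joint_LC_drop[of m r \<rho>] by (simp add: n)
    have "joint n \<rho> (\<lambda>x y. real (lcs x y)) \<le> E n \<rho> (\<lambda>l. real m + real (lcs (drop m (map fst l)) (drop m (map snd l))))"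
      unfolding joint_def by (intro E_mono[OF \<rho>]) (metis lcs_le_add_lcs_drop of_nat_add of_nat_mono)
    also have "\<dots> = real m + joint r (\<rho> v* matrix_power P m) (\<lambda>x y. real (lcs x y))"
      using joint_LC_drop[of m r \<rho>] by (simp add: n E_add E_const[OF \<rho>] joint_def)
    finally show "joint n \<rho> (\<lambda>x y. real (lcs x y)) \<le> \<dots>" .
  qed
  have "\<bar>joint r (\<nu> v* matrix_power P m) (\<lambda>x y. real (lcs x y)) - stationary_LC r\<bar>
      \<le> real r * tv_dist (\<nu> v* matrix_power P m) \<pi>"
    unfolding joint_def stationary_LC_def
    by (intro E_diff_le_tv_dist probability_vector_mult \<nu> stochastic_matrix_power stochastic \<pi>_prob)
       (use lcs_map_le_length in auto)
  also have "\<dots> \<le> real n * tv_dist (\<nu> v* matrix_power P m) \<pi>"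
    by (intro mult_right_mono tv_dist_nonneg) (simp add: n)
  finally show ?thesis
    using drop[OF \<nu>] drop[OF \<pi>_prob]
    unfolding stationary_LC_def stationary_matrix_power[OF \<pi>_fixed] by linarith
qed

lemma LC_minus_stationary_LC_sqrt:
  assumes \<nu>: "probability_vector \<nu>" and n: "n \<ge> 1"
    and \<alpha>: "\<alpha> = (1 - \<epsilon>) powr (1 / real k)" and c: "c = 1 / (1 - \<epsilon>)\<^sup>2"
  shows "\<bar>joint n \<nu> (\<lambda>x y. real (lcs x y)) / real n - stationary_LC n / real n\<bar>
    \<le> 1 / sqrt (real n) + c * \<alpha> powr sqrt (real n)"
proof -
  define m where "m = nat \<lfloor>sqrt (real n)\<rfloor>"
  have m: "real m \<le> sqrt (real n)" by (simp add: m_def)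
  have "sqrt (real n) \<le> real n"
    using n by (intro real_le_lsqrt) (auto simp: power2_eq_square)
  with m have "m \<le> n" by linarith
  then have "\<bar>joint n \<nu> (\<lambda>x y. real (lcs x y)) - stationary_LC n\<bar>
      \<le> real m + real n * tv_dist (\<nu> v* matrix_power P m) \<pi>"
    by (rule LC_minus_stationary_LC[OF \<nu>])
  also have "\<dots> \<le> sqrt (real n) + real n * (c * \<alpha> powr sqrt (real n))"
  proof (intro add_mono mult_left_mono m)
    have "tv_dist (\<nu> v* matrix_power P m) \<pi> \<le> (1 - \<epsilon>) ^ (m div k)"
      using \<epsilon>_pos \<epsilon>_less_1 minorization
      by (intro tv_dist_power_stationary_le \<nu> stationary stochastic) auto
    also have "\<dots> \<le> c * \<alpha> powr sqrt (real n)"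
      unfolding m_def by (rule contraction_rate_sqrt[OF k_pos \<epsilon>_pos \<epsilon>_less_1 \<alpha> c])
    finally show "tv_dist (\<nu> v* matrix_power P m) \<pi> \<le> c * \<alpha> powr sqrt (real n)" .
  qed simp
  finally have "\<bar>joint n \<nu> (\<lambda>x y. real (lcs x y)) - stationary_LC n\<bar> / real n
      \<le> (sqrt (real n) + real n * (c * \<alpha> powr sqrt (real n))) / real n"
    by (rule divide_right_mono) simp
  also have "\<dots> = 1 / sqrt (real n) + c * \<alpha> powr sqrt (real n)"
    using n sqrt_divide_self_eq[of "real n"] by (simp add: add_divide_distrib inverse_eq_divide)
  finally show ?thesis by (simp add: abs_divide flip: diff_divide_distrib)
qed

lemma sqrt_error_tendsto_0:
  assumes \<alpha>: "\<alpha> = (1 - \<epsilon>) powr (1 / real k)"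
  shows "(\<lambda>n. 1 / sqrt (real n) + c * \<alpha> powr sqrt (real n)) \<longlonglongrightarrow> 0"
proof -
  have \<alpha>_pos: "0 < \<alpha>" using \<epsilon>_less_1 by (simp add: \<alpha>)
  have "ln \<alpha> = ln (1 - \<epsilon>) / real k" using \<epsilon>_less_1 by (simp add: \<alpha> ln_powr)
  then have ln: "ln \<alpha> < 0" using \<epsilon>_pos \<epsilon>_less_1 k_pos by (simp add: divide_neg_pos)
  have sqrt: "filterlim (\<lambda>n. sqrt (real n)) at_top sequentially"
    by (rule filterlim_compose[OF sqrt_at_top filterlim_real_sequentially])
  have "(\<lambda>n. exp (ln \<alpha> * sqrt (real n))) \<longlonglongrightarrow> 0"
    by (rule filterlim_compose[OF exp_at_bot filterlim_tendsto_neg_mult_at_bot[OF tendsto_const ln sqrt]])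
  then have "(\<lambda>n. \<alpha> powr sqrt (real n)) \<longlonglongrightarrow> 0" using \<alpha>_pos by (simp add: powr_def mult.commute)
  moreover have "(\<lambda>n. 1 / sqrt (real n)) \<longlonglongrightarrow> 0"
    using tendsto_inverse_0_at_top[OF sqrt] by (simp add: divide_inverse)
  ultimately have "(\<lambda>n. 1 / sqrt (real n) + c * \<alpha> powr sqrt (real n)) \<longlonglongrightarrow> 0 + c * 0"
    by (intro tendsto_add tendsto_mult tendsto_const)
  then show ?thesis by simp
qed

lemma mixing_le_lim:
  assumes \<nu>: "probability_vector \<nu>"
  shows "mixing n \<nu> \<le> lim (\<lambda>n. mixing n \<nu>)"
proof -
  have mono: "incseq (\<lambda>n. mixing n \<nu>)"
  proof (rule incseq_SucI)
    show "mixing n \<nu> \<le> mixing (Suc n) \<nu>" for n using mixing_mono[OF \<nu>, of n 1] by simp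
  qed
  obtain L where "(\<lambda>n. mixing n \<nu>) \<longlonglongrightarrow> L"
    using incseq_convergent[OF mono, of 1] mixing_le_1[OF \<nu>] by blast
  then show ?thesis using incseq_le[OF mono] by (simp add: limI)
qed

text \<open>The window after time \<open>m\<close> of the chain started in \<open>\<nu>\<close> has mixing
coefficient at most the limit on the right, and its law converges to that of the stationary chain as
\<open>m\<close> grows.\<close>
lemma mixing_stationary_le:
  assumes \<nu>: "probability_vector \<nu>"
  shows "mixing n \<pi> \<le> lim (\<lambda>n. mixing n \<nu>)"
proof -
  have rate: "(\<lambda>m. 2 * (1 - \<epsilon>) ^ (m div k)) \<longlonglongrightarrow> 0"
  proof -
    have "filterlim (\<lambda>m. m div k) at_top sequentially"
      using k_pos by (intro filterlim_at_top_div_const_nat) auto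
    from filterlim_compose[OF LIMSEQ_realpow_zero this, of "1 - \<epsilon>"]
    have "(\<lambda>m. (1 - \<epsilon>) ^ (m div k)) \<longlonglongrightarrow> 0" using \<epsilon>_pos \<epsilon>_less_1 by simp
    then show ?thesis by (auto intro!: tendsto_eq_intros)
  qed
  have component: "(\<lambda>m. (\<nu> v* matrix_power P m) $ s) \<longlonglongrightarrow> \<pi> $ s" for s
  proof (rule LIM_zero_cancel, rule tendsto_rabs_zero_cancel, rule tendsto_sandwich[OF _ _ tendsto_const rate])
    have "\<bar>(\<nu> v* matrix_power P m) $ s - \<pi> $ s\<bar> \<le> 2 * (1 - \<epsilon>) ^ (m div k)" for m
    proof -
      have "\<bar>(\<nu> v* matrix_power P m) $ s - \<pi> $ s\<bar> \<le> 2 * tv_dist (\<nu> v* matrix_power P m) \<pi>"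
        unfolding tv_dist_def by (simp add: member_le_sum[of s UNIV "\<lambda>s. \<bar>(\<nu> v* matrix_power P m) $ s - \<pi> $ s\<bar>"])
      also have "\<dots> \<le> 2 * (1 - \<epsilon>) ^ (m div k)"
        using tv_dist_power_stationary_le[OF \<nu> stationary stochastic, of \<epsilon> k m] \<epsilon>_pos \<epsilon>_less_1 minorization by simp
      finally show ?thesis .
    qed
    then show "\<forall>\<^sub>F m in sequentially. \<bar>(\<nu> v* matrix_power P m) $ s - \<pi> $ s\<bar> \<le> 2 * (1 - \<epsilon>) ^ (m div k)"
      by simp
  qed simp
  have E_lim: "(\<lambda>m. E n (\<nu> v* matrix_power P m) f) \<longlonglongrightarrow> E n \<pi> f" for f
    unfolding E_def by (intro tendsto_intros component)
  have "indep n \<rho> F = (\<Sum>t\<in>UNIV. \<rho> $ t * E n \<rho> (\<lambda>l. E_from n t (\<lambda>l'. F (map fst l) (map snd l'))))" for \<rho> F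
    unfolding indep_def by (simp add: E_def[of n \<rho> "\<lambda>l'. F u (map snd l')" for u] E_sum E_cmult)
  then have "(\<lambda>m. mixing n (\<nu> v* matrix_power P m)) \<longlonglongrightarrow> mixing n \<pi>"
    unfolding mixing_def joint_def
    by (simp only:) (intro tendsto_intros E_lim component)
  moreover have "mixing n (\<nu> v* matrix_power P m) \<le> lim (\<lambda>n. mixing n \<nu>)" for m
    using mixing_shift_le[OF \<nu>, of n m] mixing_le_lim[OF \<nu>, of "m + n"] by linarith
  ultimately show ?thesis by (intro LIMSEQ_le_const2) auto
qed

end

section \<open>Finite-dimensional distributions of a hidden Markov model\<close>

lemma (in prob_space) prob_partition:
  assumes "finite S" "\<And>\<omega>. \<omega> \<in> space M \<Longrightarrow> W \<omega> \<in> S"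
    and "\<And>s. s \<in> S \<Longrightarrow> {\<omega> \<in> space M. W \<omega> = s \<and> Q \<omega>} \<in> events"
  shows "prob {\<omega> \<in> space M. Q \<omega>} = (\<Sum>s\<in>S. prob {\<omega> \<in> space M. W \<omega> = s \<and> Q \<omega>})"
proof -
  have "{\<omega> \<in> space M. Q \<omega>} = (\<Union>s\<in>S. {\<omega> \<in> space M. W \<omega> = s \<and> Q \<omega>})"
    using assms(2) by auto
  then show ?thesis
    using assms by (simp add: finite_measure_finite_Union disjoint_family_on_def disjoint_iff image_subset_iff)
qed

lemma sum_lists_length_Suc:
  fixes f :: "'s::finite list \<Rightarrow> real"
  shows "(\<Sum>ss | length ss = Suc n. f ss) = (\<Sum>s\<in>UNIV. \<Sum>ss | length ss = n. f (s # ss))"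
proof -
  have "(\<Sum>s\<in>UNIV. \<Sum>ss | length ss = n. f (s # ss)) =
      (\<Sum>p\<in>UNIV \<times> {ss. length ss = n}. f (fst p # snd p))"
    by (simp add: sum.cartesian_product case_prod_unfold)
  also have "\<dots> = (\<Sum>ss | length ss = Suc n. f ss)"
    by (rule sum.reindex_bij_witness[of _ "\<lambda>ss. (hd ss, tl ss)" "\<lambda>p. fst p # snd p"])
       (auto simp: length_Suc_conv)
  finally show ?thesis by simp
qed

lemma finite_lists_length: "finite {ss :: 's::finite list. length ss = n}"
  using finite_lists_length_eq[of "UNIV :: 's set" n] by simp

context emission_kernel
begin

primrec path_weight :: "real ^ 's \<Rightarrow> 's list \<Rightarrow> real" where
  "path_weight \<nu> [] = 1"
| "path_weight \<nu> (s # ss) = \<nu> $ s * path_weight (P $ s) ss"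

lemma path_weight_snoc:
  "path_weight \<nu> (ss @ [t]) = path_weight \<nu> ss * (if ss = [] then \<nu> else P $ last ss) $ t"
  by (induction ss arbitrary: \<nu>) auto

lemma sum_path_weight_snoc:
  "(\<Sum>ss | length ss = n. path_weight \<nu> (ss @ [t])) = (\<nu> v* matrix_power P n) $ t"
proof (induction n arbitrary: \<nu>)
  case (Suc n)
  have "(\<Sum>ss | length ss = Suc n. path_weight \<nu> (ss @ [t]))
      = (\<Sum>s\<in>UNIV. \<nu> $ s * (P $ s v* matrix_power P n) $ t)"
    by (simp add: sum_lists_length_Suc Suc.IH flip: sum_distrib_left)
  also have "\<dots> = (\<nu> v* matrix_power P (Suc n)) $ t"
    by (simp add: vector_matrix_nth matrix_matrix_mult_def)
  finally show ?case .
qed simp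

text \<open>The form in which the defining properties of a hidden Markov model give these probabilities: each
latent path contributes separately.\<close>
lemma E_of_bool_eq_paths:
  assumes "probability_vector \<nu>" "length w = n"
  shows "E n \<nu> (\<lambda>l. of_bool (l = w)) =
    (\<Sum>ss | length ss = n. path_weight \<nu> ss * (\<Prod>i<n. pmf (e (ss ! i)) (w ! i)))"
  using assms
proof (induction n arbitrary: \<nu> w)
  case 0
  then show ?case by (simp add: E_def probability_vector_def)
next
  case (Suc n)
  then obtain z w' where w: "w = z # w'" "length w' = n" by (auto simp: length_Suc_conv)
  have emit: "(\<Sum>z'\<in>UNIV. pmf (e s) z' * (\<Sum>t\<in>UNIV. P $ s $ t * E_from n t (\<lambda>l. of_bool (z' # l = w))))
      = pmf (e s) z * E n (P $ s) (\<lambda>l. of_bool (l = w'))" for s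
  proof -
    have "pmf (e s) z' * (\<Sum>t\<in>UNIV. P $ s $ t * E_from n t (\<lambda>l. of_bool (z' # l = w)))
        = (if z = z' then pmf (e s) z * E n (P $ s) (\<lambda>l. of_bool (l = w')) else 0)" for z'
      using w by (simp add: E_def E_from_const)
    then show ?thesis by simp
  qed
  have row: "probability_vector (P $ s)" for s using stochastic by (simp add: stochastic_matrix_def)
  have "E (Suc n) \<nu> (\<lambda>l. of_bool (l = w)) = (\<Sum>s\<in>UNIV. \<nu> $ s * (pmf (e s) z * E n (P $ s) (\<lambda>l. of_bool (l = w'))))"
    by (simp add: E_def[of "Suc n"] emit)
  also have "\<dots> = (\<Sum>s\<in>UNIV. \<Sum>ss | length ss = n. path_weight \<nu> (s # ss) *
      (\<Prod>i<Suc n. pmf (e ((s # ss) ! i)) (w ! i)))"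
    by (simp add: Suc.IH[OF row w(2)] w(1) prod.lessThan_Suc_shift sum_distrib_left mult_ac
        del: prod.lessThan_Suc)
  finally show ?case by (simp add: sum_lists_length_Suc del: prod.lessThan_Suc)
qed

end

context hidden_markov_model
begin

sublocale kernel: emission_kernel P e
  by unfold_locales (rule stochastic)

definition states :: "nat \<Rightarrow> 'w \<Rightarrow> 's list" where
  "states n \<omega> = map (\<lambda>i. Z i \<omega>) [1..<Suc n]"

definition pairs :: "nat \<Rightarrow> 'w \<Rightarrow> ('a \<times> 'a) list" where
  "pairs n \<omega> = map (\<lambda>i. (X i \<omega>, Y i \<omega>)) [1..<Suc n]"

lemma map_upt_eq_iff:
  "length w = n \<Longrightarrow> map f [1..<Suc n] = w \<longleftrightarrow> (\<forall>i\<in>{1..n}. f i = w ! (i - 1))"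
proof -
  assume "length w = n"
  then have "map f [1..<Suc n] = w \<longleftrightarrow> (\<forall>i<n. f (Suc i) = w ! i)"
    by (auto simp: list_eq_iff_nth_eq simp del: upt_Suc)
  also have "\<dots> \<longleftrightarrow> (\<forall>i\<in>{1..n}. f i = w ! (i - 1))"
    by (metis One_nat_def Suc_le_eq Suc_pred atLeastAtMost_iff diff_Suc_1 le_add1 plus_1_eq_Suc zero_less_Suc)
  finally show ?thesis .
qed

lemma length_states [simp]: "length (states n \<omega>) = n" and length_pairs [simp]: "length (pairs n \<omega>) = n"
  by (simp_all add: states_def pairs_def)

lemma states_eq_iff: "length ss = n \<Longrightarrow> states n \<omega> = ss \<longleftrightarrow> (\<forall>i\<in>{1..n}. Z i \<omega> = ss ! (i - 1))"
  unfolding states_def by (rule map_upt_eq_iff)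

lemma pairs_eq_iff: "length w = n \<Longrightarrow> pairs n \<omega> = w \<longleftrightarrow> (\<forall>i\<in>{1..n}. (X i \<omega>, Y i \<omega>) = w ! (i - 1))"
  unfolding pairs_def by (rule map_upt_eq_iff)

lemma states_Suc: "states (Suc n) \<omega> = states n \<omega> @ [Z (Suc n) \<omega>]"
  by (simp add: states_def)

lemma space_latent: "space (latent_algebra M Z) = space M"
  unfolding latent_algebra_def by (rule space_measure_of) auto

lemma sets_latent:
  "sets (latent_algebra M Z) = sigma_sets (space M) {Z n -` B \<inter> space M | n B. n \<ge> 1}"
  unfolding latent_algebra_def by (rule sets_measure_of) auto

lemma Z_measurable_latent: "n \<ge> 1 \<Longrightarrow> Z n \<in> measurable (latent_algebra M Z) (count_space UNIV)"
  by (rule measurableI) (auto simp: space_latent sets_latent intro!: sigma_sets.Basic)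

lemma latent_subalgebra: "subalgebra M (latent_algebra M Z)"
proof -
  have "sigma_sets (space M) {Z n -` B \<inter> space M | n B. n \<ge> 1} \<subseteq> sets M"
    using measurable_sets[OF Z_measurable] by (intro sets.sigma_sets_subset) auto
  then show ?thesis by (simp add: subalgebra_def space_latent sets_latent)
qed

sublocale latent: sigma_finite_subalgebra M "latent_algebra M Z"
proof (rule finite_measure_subalgebra_is_sigma_finite)
  show "finite_measure_subalgebra M (latent_algebra M Z)"
    by (intro_locales) (simp add: finite_measure_subalgebra_axioms_def latent_subalgebra)
qed

lemma states_event_latent:
  assumes "length ss = n"
  shows "{\<omega> \<in> space M. states n \<omega> = ss} \<in> sets (latent_algebra M Z)"
proof -
  have "{\<omega> \<in> space (latent_algebra M Z). \<forall>i\<in>{1..n}. Z i \<omega> = ss ! (i - 1)} \<in> sets (latent_algebra M Z)"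
  proof (rule sets.sets_Collect_finite_All)
    fix i assume "i \<in> {1..n}"
    then have "Z i -` {ss ! (i - 1)} \<inter> space (latent_algebra M Z) \<in> sets (latent_algebra M Z)"
      by (intro measurable_sets[OF Z_measurable_latent]) auto
    then show "{\<omega> \<in> space (latent_algebra M Z). Z i \<omega> = ss ! (i - 1)} \<in> sets (latent_algebra M Z)"
      by (simp add: vimage_def Int_def conj_commute)
  qed simp
  then show ?thesis by (simp add: states_eq_iff[OF assms] space_latent)
qed

lemma Z_event_latent: "n \<ge> 1 \<Longrightarrow> {\<omega> \<in> space M. Z n \<omega> = s} \<in> sets (latent_algebra M Z)"
  using measurable_sets[OF Z_measurable_latent, of n "{s}"]
  by (simp add: vimage_def Int_def conj_commute space_latent)

lemma latent_event: "A \<in> sets (latent_algebra M Z) \<Longrightarrow> A \<in> events"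
  using latent_subalgebra by (auto simp: subalgebra_def)

lemma pair_event: "n \<ge> 1 \<Longrightarrow> {\<omega> \<in> space M. (X n \<omega>, Y n \<omega>) \<in> B} \<in> events"
proof -
  assume n: "n \<ge> 1"
  have "(\<lambda>\<omega>. (X n \<omega>, Y n \<omega>)) -` B \<inter> space M = (\<Union>(x, y)\<in>B. (X n -` {x} \<inter> space M) \<inter> (Y n -` {y} \<inter> space M))"
    by auto
  also have "\<dots> \<in> events"
  proof (intro sets.finite_UN)
    have "(X n -` {x} \<inter> space M) \<inter> (Y n -` {y} \<inter> space M) \<in> events" for x y
      by (intro sets.Int measurable_sets[OF X_measurable[OF n]] measurable_sets[OF Y_measurable[OF n]]) auto
    then show "(case p of (x, y) \<Rightarrow> (X n -` {x} \<inter> space M) \<inter> (Y n -` {y} \<inter> space M)) \<in> events" for p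
      by (simp only: case_prod_unfold)
  qed simp
  finally show ?thesis by (simp add: vimage_def Int_def conj_commute)
qed

lemma pairs_on_event:
  assumes "finite I" "I \<subseteq> {1..}"
  shows "{\<omega> \<in> space M. \<forall>i\<in>I. (X i \<omega>, Y i \<omega>) \<in> B i} \<in> events"
  using assms by (intro sets.sets_Collect_finite_All pair_event) auto

lemma pairs_event: "length w = n \<Longrightarrow> {\<omega> \<in> space M. pairs n \<omega> = w} \<in> events"
  using pairs_on_event[of "{1..n}" "\<lambda>i. {w ! (i - 1)}"] by (simp add: pairs_eq_iff)

text \<open>Integrating the conditional probability given the latent chain over an event \<open>A\<close> of
that chain; on \<open>A\<close> the states at the times in \<open>I\<close> are prescribed, so the conditional
probability is constant there.\<close>
lemma prob_pairs_on_latent_event: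
  assumes I: "finite I" "I \<subseteq> {1..}" and A: "A \<in> sets (latent_algebra M Z)"
    and z: "\<And>\<omega> i. \<omega> \<in> A \<Longrightarrow> i \<in> I \<Longrightarrow> Z i \<omega> = z i"
  shows "prob (A \<inter> {\<omega> \<in> space M. \<forall>i\<in>I. (X i \<omega>, Y i \<omega>) \<in> B i})
    = prob A * (\<Prod>i\<in>I. measure_pmf.prob (e (z i)) (B i))"
proof -
  define D where "D = {\<omega> \<in> space M. \<forall>i\<in>I. (X i \<omega>, Y i \<omega>) \<in> B i}"
  have D: "D \<in> events" unfolding D_def by (rule pairs_on_event[OF I])
  have AM: "A \<in> events" by (rule latent_event[OF A])
  have "AE \<omega> in M. \<forall>i\<in>I. prob_given_latent M Z (\<lambda>\<omega>. (X i \<omega>, Y i \<omega>) \<in> B i) \<omega>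
      = measure_pmf.prob (e (Z i \<omega>)) (B i)"
    using I emission by (intro AE_finite_allI) auto
  then have ae: "AE \<omega> in M. indicator A \<omega> * prob_given_latent M Z (\<lambda>\<omega>. \<forall>i\<in>I. (X i \<omega>, Y i \<omega>) \<in> B i) \<omega>
      = indicator A \<omega> * (\<Prod>i\<in>I. measure_pmf.prob (e (z i)) (B i))"
    using cond_indep[OF I, of B]
  proof eventually_elim
    case (elim \<omega>)
    then show ?case using z[of \<omega>] by (cases "\<omega> \<in> A") (auto intro!: prod.cong)
  qed
  have "prob (A \<inter> D) = (\<integral>\<omega>\<in>A. indicator D \<omega> \<partial>M)"
    using AM D by (simp add: set_lebesgue_integral_def indicator_inter_arith[symmetric])
  also have "\<dots> = (\<integral>\<omega>\<in>A. real_cond_exp M (latent_algebra M Z) (indicator D) \<omega> \<partial>M)"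
    using A D by (intro latent.real_cond_exp_intA) (auto simp: emeasure_eq_measure)
  also have "\<dots> = (\<integral>\<omega>. indicator A \<omega> * (\<Prod>i\<in>I. measure_pmf.prob (e (z i)) (B i)) \<partial>M)"
    unfolding set_lebesgue_integral_def
    using ae AM borel_measurable_cond_exp2
    by (intro integral_cong_AE) (auto simp: prob_given_latent_def D_def)
  also have "\<dots> = prob A * (\<Prod>i\<in>I. measure_pmf.prob (e (z i)) (B i))"
    using AM by simp
  finally show ?thesis by (simp add: D_def)
qed

lemma prob_states: "length ss = n \<Longrightarrow> prob {\<omega> \<in> space M. states n \<omega> = ss} = kernel.path_weight \<mu> ss"
proof (induction n arbitrary: ss)
  case 0
  then show ?case by (simp add: states_def prob_space)
next
  case (Suc n)
  then obtain rs t where ss: "ss = rs @ [t]" "length rs = n"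
    by (metis length_Suc_conv_rev)
  have event: "{\<omega> \<in> space M. states (Suc n) \<omega> = ss} = {\<omega> \<in> space M. states n \<omega> = rs \<and> Z (Suc n) \<omega> = t}"
    by (auto simp: states_Suc ss)
  show ?case
  proof (cases n)
    case 0
    then show ?thesis using initial[of t] ss(2) by (simp add: event ss(1) states_def)
  next
    case (Suc n')
    have IH: "prob {\<omega> \<in> space M. states n \<omega> = rs} = kernel.path_weight \<mu> rs"
      by (rule Suc.IH[OF ss(2)])
    have weight: "kernel.path_weight \<mu> ss = kernel.path_weight \<mu> rs * P $ (rs ! (n - 1)) $ t"
      using ss(2) Suc by (auto simp: ss(1) kernel.path_weight_snoc last_conv_nth)
    have R: "{\<omega> \<in> space M. states n \<omega> = rs} \<in> events"
      by (intro latent_event states_event_latent ss)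
    show ?thesis
    proof (cases "prob {\<omega> \<in> space M. states n \<omega> = rs} = 0")
      case True
      have "prob {\<omega> \<in> space M. states (Suc n) \<omega> = ss} \<le> prob {\<omega> \<in> space M. states n \<omega> = rs}"
        unfolding event by (intro finite_measure_mono R) auto
      \<comment> \<open>The transition law is not prescribed after a null path, but then both sides vanish.\<close>
      then show ?thesis using True IH weight by (simp add: measure_le_0_iff)
    next
      case False
      then have pos: "prob {\<omega> \<in> space M. \<forall>i\<in>{1..n}. Z i \<omega> = rs ! (i - 1)} > 0"
        using measure_nonneg[of M "{\<omega> \<in> space M. states n \<omega> = rs}"]
        by (simp add: states_eq_iff[OF ss(2)] less_le)
      have "\<P>(\<omega> in M. Z (Suc n) \<omega> = t \<bar> \<forall>i\<in>{1..n}. Z i \<omega> = rs ! (i - 1)) = P $ (rs ! (n - 1)) $ t"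
        by (rule transition[OF _ pos]) (use Suc in simp)
      then have "prob {\<omega> \<in> space M. Z (Suc n) \<omega> = t \<and> states n \<omega> = rs}
          = P $ (rs ! (n - 1)) $ t * prob {\<omega> \<in> space M. states n \<omega> = rs}"
        using pos by (simp add: cond_prob_def states_eq_iff[OF ss(2)] divide_eq_eq)
      then show ?thesis using IH weight by (simp add: event conj_commute mult.commute)
    qed
  qed
qed

lemma \<mu>_prob: "probability_vector \<mu>"
proof -
  have "prob {\<omega> \<in> space M. True} = (\<Sum>s\<in>UNIV. prob {\<omega> \<in> space M. Z 1 \<omega> = s \<and> True})"
    using Z_event_latent[of 1] by (intro prob_partition) (auto intro: latent_event)
  then show ?thesis
    using initial prob_space by (auto simp: probability_vector_def simp flip: initial)
qed

lemma prob_Z_Suc: "prob {\<omega> \<in> space M. Z (Suc n) \<omega> = t} = (\<mu> v* matrix_power P n) $ t"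
proof -
  have event: "{\<omega> \<in> space M. states n \<omega> = ss \<and> Z (Suc n) \<omega> = t} = {\<omega> \<in> space M. states (Suc n) \<omega> = ss @ [t]}" for ss
    by (auto simp: states_Suc)
  have "prob {\<omega> \<in> space M. Z (Suc n) \<omega> = t} =
      (\<Sum>ss | length ss = n. prob {\<omega> \<in> space M. states n \<omega> = ss \<and> Z (Suc n) \<omega> = t})"
    by (rule prob_partition) (auto simp: finite_lists_length event intro!: latent_event states_event_latent)
  then show ?thesis
    by (simp add: event prob_states kernel.sum_path_weight_snoc)
qed

lemma prob_pairs: "length w = n \<Longrightarrow> prob {\<omega> \<in> space M. pairs n \<omega> = w} = kernel.E n \<mu> (\<lambda>l. of_bool (l = w))"
proof -
  assume w: "length w = n"
  have event: "{\<omega> \<in> space M. states n \<omega> = ss \<and> pairs n \<omega> = w} =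
      {\<omega> \<in> space M. states n \<omega> = ss} \<inter> {\<omega> \<in> space M. \<forall>i\<in>{1..n}. (X i \<omega>, Y i \<omega>) \<in> {w ! (i - 1)}}" for ss
    by (auto simp: pairs_eq_iff[OF w])
  have path: "prob {\<omega> \<in> space M. states n \<omega> = ss \<and> pairs n \<omega> = w} =
      kernel.path_weight \<mu> ss * (\<Prod>i<n. pmf (e (ss ! i)) (w ! i))" if ss: "length ss = n" for ss
  proof -
    have "prob {\<omega> \<in> space M. states n \<omega> = ss \<and> pairs n \<omega> = w} =
        prob {\<omega> \<in> space M. states n \<omega> = ss} *
        (\<Prod>i\<in>{1..n}. measure_pmf.prob (e (ss ! (i - 1))) {w ! (i - 1)})"
      unfolding event
      by (rule prob_pairs_on_latent_event[OF _ _ states_event_latent[OF ss]])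
         (auto simp: states_eq_iff[OF ss])
    also have "(\<Prod>i\<in>{1..n}. measure_pmf.prob (e (ss ! (i - 1))) {w ! (i - 1)}) = (\<Prod>i<n. pmf (e (ss ! i)) (w ! i))"
      by (rule prod.reindex_bij_witness[of _ Suc "\<lambda>i. i - 1"]) (auto simp: measure_pmf_single)
    finally show ?thesis by (simp add: prob_states[OF ss])
  qed
  have "prob {\<omega> \<in> space M. pairs n \<omega> = w} =
      (\<Sum>ss | length ss = n. prob {\<omega> \<in> space M. states n \<omega> = ss \<and> pairs n \<omega> = w})"
  proof (rule prob_partition)
    fix ss :: "'s list" assume "ss \<in> {ss. length ss = n}"
    then have ss: "length ss = n" by simp
    have "{\<omega> \<in> space M. states n \<omega> = ss} \<inter> {\<omega> \<in> space M. pairs n \<omega> = w} \<in> events"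
      by (intro sets.Int latent_event states_event_latent[OF ss] pairs_event[OF w])
    also have "{\<omega> \<in> space M. states n \<omega> = ss} \<inter> {\<omega> \<in> space M. pairs n \<omega> = w}
        = {\<omega> \<in> space M. states n \<omega> = ss \<and> pairs n \<omega> = w}" by auto
    finally show "{\<omega> \<in> space M. states n \<omega> = ss \<and> pairs n \<omega> = w} \<in> events" .
  qed (auto simp: finite_lists_length)
  then show ?thesis by (simp add: path kernel.E_of_bool_eq_paths[OF \<mu>_prob w])
qed

lemma expectation_pairs: "expectation (\<lambda>\<omega>. f (pairs n \<omega>)) = kernel.E n \<mu> f"
proof -
  let ?L = "{w :: ('a \<times> 'a) list. length w = n}"
  have sum: "(\<Sum>w\<in>?L. f w * of_bool (l = w)) = f l" if "length l = n" for l
  proof -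
    have "(\<Sum>w\<in>?L. f w * of_bool (l = w)) = (\<Sum>w\<in>?L. if l = w then f w else 0)"
      by (rule sum.cong) auto
    then show ?thesis using that by (simp add: finite_lists_length)
  qed
  have "expectation (\<lambda>\<omega>. f (pairs n \<omega>)) =
      expectation (\<lambda>\<omega>. \<Sum>w\<in>?L. f w * indicator {\<omega> \<in> space M. pairs n \<omega> = w} \<omega>)"
  proof (rule Bochner_Integration.integral_cong[OF refl])
    fix \<omega> assume "\<omega> \<in> space M"
    then have "indicator {\<omega> \<in> space M. pairs n \<omega> = w} \<omega> = (of_bool (pairs n \<omega> = w) :: real)" for w
      by (simp add: indicator_def)
    then show "f (pairs n \<omega>) = (\<Sum>w\<in>?L. f w * indicator {\<omega> \<in> space M. pairs n \<omega> = w} \<omega>)"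
      by (simp only: sum length_pairs)
  qed
  also have "\<dots> = (\<Sum>w\<in>?L. f w * prob {\<omega> \<in> space M. pairs n \<omega> = w})"
    by (subst Bochner_Integration.integral_sum)
       (auto simp: pairs_event emeasure_eq_measure intro!: integrable_mult_right integrable_real_indicator)
  also have "\<dots> = kernel.E n \<mu> (\<lambda>l. \<Sum>w\<in>?L. f w * of_bool (l = w))"
    by (simp add: prob_pairs kernel.E_sum kernel.E_cmult)
  also have "\<dots> = kernel.E n \<mu> f"
    by (rule kernel.E_cong) (rule sum)
  finally show ?thesis .
qed

lemma expected_LC_eq_joint: "expected_LC M X Y n = kernel.joint n \<mu> (\<lambda>x y. real (lcs x y))"
proof -
  have "lcs_length n (\<lambda>i. X i \<omega>) (\<lambda>i. Y i \<omega>) = lcs (map fst (pairs n \<omega>)) (map snd (pairs n \<omega>))" for \<omega>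
    by (simp add: lcs_length_eq_lcs pairs_def comp_def)
  then show ?thesis
    using expectation_pairs[of "\<lambda>l. real (lcs (map fst l) (map snd l))" n]
    by (simp add: expected_LC_def kernel.joint_def)
qed

lemma prob_pairs_property: "prob {\<omega> \<in> space M. Q (pairs n \<omega>)} = kernel.E n \<mu> (\<lambda>l. of_bool (Q l))"
proof -
  have event: "{\<omega> \<in> space M. Q (pairs n \<omega>)} \<in> events"
  proof -
    have "{\<omega> \<in> space M. Q (pairs n \<omega>)} = (\<Union>w\<in>{w. length w = n \<and> Q w}. {\<omega> \<in> space M. pairs n \<omega> = w})"
      by auto
    also have "\<dots> \<in> events"
      by (intro sets.finite_UN pairs_event) (auto intro: finite_subset[OF _ finite_lists_length[of n]])
    finally show ?thesis .
  qed
  have "kernel.E n \<mu> (\<lambda>l. of_bool (Q l)) = expectation (indicator {\<omega> \<in> space M. Q (pairs n \<omega>)})"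
    unfolding expectation_pairs[symmetric]
    by (rule Bochner_Integration.integral_cong) (auto simp: indicator_def)
  then show ?thesis using event by simp
qed

lemma beta_mixing_eq_mixing: "beta_mixing M X Y n = kernel.mixing n \<mu>"
proof -
  have words: "word X n \<omega> = map fst (pairs n \<omega>)" "word Y n \<omega> = map snd (pairs n \<omega>)" for \<omega>
    by (simp_all add: word_def pairs_def comp_def)
  have "\<P>(\<omega> in M. word X n \<omega> = u \<and> word Y n \<omega> = v)
      = kernel.joint n \<mu> (\<lambda>x y. of_bool (x = u \<and> y = v))" for u v
    unfolding words kernel.joint_def by (rule prob_pairs_property)
  moreover have "\<P>(\<omega> in M. word X n \<omega> = u) * \<P>(\<omega> in M. word Y n \<omega> = v)
      = kernel.indep n \<mu> (\<lambda>x y. of_bool (x = u \<and> y = v))" for u v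
    unfolding words kernel.indep_def of_bool_conj kernel.E_cmult kernel.E_cmult_right
    using prob_pairs_property[of "\<lambda>l. map fst l = u" n] prob_pairs_property[of "\<lambda>l. map snd l = v" n]
    by simp
  ultimately show ?thesis
    by (simp add: beta_mixing_def kernel.mixing_def kernel.words_def)
qed

text \<open>Symmetry is a property of the conditional laws under the model; it passes to the emission
distribution of a state as soon as that state has positive probability at some time.\<close>
lemma emission_symmetric_if_visited:
  assumes symmetric: "symmetric_emissions M Z X Y"
    and i: "i \<ge> 1" "prob {\<omega> \<in> space M. Z i \<omega> = s} > 0"
  shows "pmf (e s) (x, y) = pmf (e s) (y, x)"
proof -
  have emit: "\<P>(\<omega> in M. X i \<omega> = x \<and> Y i \<omega> = y \<bar> Z i \<omega> = s) = pmf (e s) (x, y)" for x y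
  proof -
    have "prob {\<omega> \<in> space M. (X i \<omega> = x \<and> Y i \<omega> = y) \<and> Z i \<omega> = s} =
        prob ({\<omega> \<in> space M. Z i \<omega> = s} \<inter> {\<omega> \<in> space M. \<forall>j\<in>{i}. (X j \<omega>, Y j \<omega>) \<in> {(x, y)}})"
      by (rule arg_cong[of _ _ prob]) auto
    also have "\<dots> = prob {\<omega> \<in> space M. Z i \<omega> = s} * (\<Prod>j\<in>{i}. measure_pmf.prob (e s) {(x, y)})"
      using i(1) by (intro prob_pairs_on_latent_event) (auto intro: Z_event_latent)
    finally show ?thesis using i(2) by (simp add: cond_prob_def measure_pmf_single)
  qed
  have "\<P>(\<omega> in M. X i \<omega> = x \<and> Y i \<omega> = y \<bar> Z i \<omega> = s)
      = \<P>(\<omega> in M. X i \<omega> = y \<and> Y i \<omega> = x \<bar> Z i \<omega> = s)"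
    using symmetric i(1) unfolding symmetric_emissions_def by blast
  then show ?thesis by (simp only: emit)
qed

end

section \<open>The rate of convergence\<close>

theorem theorem3p1:
  fixes M :: "'w measure"
    and Z :: "nat \<Rightarrow> 'w \<Rightarrow> 's::finite"
    and X Y :: "nat \<Rightarrow> 'w \<Rightarrow> 'a::finite"
    and \<mu> \<pi> :: "real ^ 's"
    and P :: "real ^ 's ^ 's"
    and e :: "'s \<Rightarrow> ('a \<times> 'a) pmf"
    and k :: nat
    and \<epsilon> \<alpha> c :: real
  assumes hmm: "hidden_markov_model M Z X Y \<mu> P e"
    and irreducible: "irreducible_matrix P"
    and aperiodic: "aperiodic_matrix P"
    and stationary: "stationary_distribution P \<pi>"
    and symmetric: "symmetric_emissions M Z X Y"
    and k: "k \<ge> 1"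
    and \<epsilon>: "0 < \<epsilon>" "\<epsilon> < 1"
    and minorization: "\<And>s t. matrix_power P k $ s $ t \<ge> \<epsilon>"
    and \<alpha>: "\<alpha> = (1 - \<epsilon>) powr (1 / real k)"
    and c: "c = 1 / (1 - \<epsilon>)\<^sup>2"
  shows "(\<exists>C>0. \<forall>n\<ge>2.
            expected_LC M X Y n / real n
              \<ge> gamma_star M X Y - 2 * beta_star M X Y - C * sqrt (ln (real n) / real n) - 2 / real n
                - (1 - of_bool (\<mu> = \<pi>)) * (1 / sqrt (real n) + c * \<alpha> powr sqrt (real n)))
       \<and> (\<forall>n\<ge>2.
            expected_LC M X Y n / real n
              \<le> gamma_star M X Y
                + (1 - of_bool (\<mu> = \<pi>)) * (1 / sqrt (real n) + c * \<alpha> powr sqrt (real n)))"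
proof -
  interpret hidden_markov_model M Z X Y \<mu> P e by (rule hmm)
  \<comment> \<open>After \<open>k\<close> steps all states have positive probability, so all emission distributions are symmetric.\<close>
  have visited: "prob {\<omega> \<in> space M. Z (Suc k) \<omega> = s} > 0" for s
  proof -
    have "\<epsilon> = (\<Sum>t\<in>UNIV. \<mu> $ t * \<epsilon>)"
      using \<mu>_prob by (simp add: probability_vector_def flip: sum_distrib_right)
    also have "\<dots> \<le> (\<mu> v* matrix_power P k) $ s"
      unfolding vector_matrix_nth using \<mu>_prob minorization
      by (intro sum_mono mult_left_mono) (auto simp: probability_vector_def)
    finally show ?thesis using \<epsilon>(1) by (simp add: prob_Z_Suc)
  qed
  have "pmf (e s) (x, y) = pmf (e s) (y, x)" for s x y
    by (rule emission_symmetric_if_visited[OF symmetric _ visited]) simp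
  then interpret stationary_kernel P e k \<epsilon> \<pi>
    by unfold_locales (use k \<epsilon> minorization stationary in auto)
  \<comment> \<open>For \<open>\<mu> = \<pi>\<close> the two expectations agree, and nothing is lost in passing between them.\<close>
  define err where "err n = (1 - of_bool (\<mu> = \<pi>)) * (1 / sqrt (real n) + c * \<alpha> powr sqrt (real n))" for n
  obtain \<gamma> where \<gamma>: "(\<lambda>n. stationary_LC n / real n) \<longlonglongrightarrow> \<gamma>"
    "\<And>n. n \<ge> 1 \<Longrightarrow> stationary_LC n / real n \<le> \<gamma>"
    using superadditive_limit[OF stationary_LC_superadditive stationary_LC_bounds] by blast
  have close: "\<bar>expected_LC M X Y n / real n - stationary_LC n / real n\<bar> \<le> err n" if "n \<ge> 1" for n
  proof (cases "\<mu> = \<pi>")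
    case True
    then show ?thesis by (simp add: expected_LC_eq_joint stationary_LC_def err_def)
  next
    case False
    then show ?thesis
      using LC_minus_stationary_LC_sqrt[OF \<mu>_prob that \<alpha> c] by (simp add: expected_LC_eq_joint err_def)
  qed
  have "err \<longlonglongrightarrow> (1 - of_bool (\<mu> = \<pi>)) * 0"
    unfolding err_def by (intro tendsto_mult tendsto_const sqrt_error_tendsto_0 \<alpha>)
  then have err: "err \<longlonglongrightarrow> 0" by simp
  have "(\<lambda>n. expected_LC M X Y n / real n - stationary_LC n / real n) \<longlonglongrightarrow> 0"
  proof (rule tendsto_rabs_zero_cancel, rule tendsto_sandwich[OF _ _ tendsto_const err])
    show "\<forall>\<^sub>F n in sequentially. \<bar>expected_LC M X Y n / real n - stationary_LC n / real n\<bar> \<le> err n"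
      using close unfolding eventually_sequentially by blast
  qed simp
  from tendsto_add[OF this \<gamma>(1)] have gamma: "gamma_star M X Y = \<gamma>"
    unfolding gamma_star_def by (intro limI) simp
  have mixing: "kernel.mixing n \<pi> \<le> beta_star M X Y" for n
  proof -
    have "beta_mixing M X Y = (\<lambda>n. kernel.mixing n \<mu>)" by (rule ext) (rule beta_mixing_eq_mixing)
    then show ?thesis using mixing_stationary_le[OF \<mu>_prob] by (simp add: beta_star_def)
  qed
  show ?thesis
    unfolding err_def[symmetric] gamma
  proof (intro conjI exI[of _ "4 + spread\<^sup>2 / 4"] allI impI)
    show "0 < 4 + spread\<^sup>2 / 4" by (simp add: add_pos_nonneg)
    fix n :: nat assume n: "n \<ge> 2"
    then have gap: "\<bar>expected_LC M X Y n / real n - stationary_LC n / real n\<bar> \<le> err n"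
      by (intro close) simp
    show "\<gamma> - 2 * beta_star M X Y - (4 + spread\<^sup>2 / 4) * sqrt (ln (real n) / real n) - 2 / real n - err n
        \<le> expected_LC M X Y n / real n"
      using gap stationary_rate[OF \<gamma>(1) mixing n] by linarith
    show "expected_LC M X Y n / real n \<le> \<gamma> + err n"
      using gap \<gamma>(2)[of n] n by linarith
  qed
qed

end
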